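(* Let $\delta$ be a positive real number. There exist a probability space $(\Omega,\mathcal F,\mu)$, a one-to-one, bi-measurable, measure preserving map $T\colon\Omega\to\Omega$ and a zero mean square integrable measurable function $f\colon\Omega\to\mathbb R$ such that the strictly stationary process $Y=(Y_k)=(f\circ T^k)$ satisfies all of the following conditions: (a) the central limit theorem with normalization $\sqrt n$ holds for $Y$; (b) the weak invariance principle with normalization $\sqrt n$ does not hold for $Y$, neither in $C[0,1]$ nor in $D[0,1]$; (c) $\sigma_N(f)^2\asymp N$; (d) there is a constant $C>0$ such that $\beta_Y(N)\leqslant C/N^{1/2-\delta}$ for every $N\geqslant 1$; (e) $Y_0\in\mathbb L^p$ for every $p>0$.
   Context: For a zero mean square integrable $f\colon\Omega\to\mathbb R$: $S_n(f):=\sum_{j=0}^{n-1}f\circ T^j$, $\sigma_n^2(f):=\mathbb E(S_n(f)^2)$, and for $t\in[0,1]$, $S_n^*(f,t):=S_{\lfloor nt\rfloor}(f)+(nt-\lfloor nt\rfloor)f\circ T^{\lfloor nt\rfloor}$ and $S_n^{**}(f,t):=S_{\lfloor nt\rfloor}(f)$. The central limit theorem with normalization $a_n$ holds if $a_n^{-1}S_n(f)$ converges weakly to a standard normal distribution. The weak invariance principle in $C[0,1]$ (resp. $D[0,1]$) with normalization $a_n$ holds if the random elements $a_n^{-1}S_n^*(f,\cdot)$ of $C[0,1]$ with the sup norm (resp. $a_n^{-1}S_n^{**}(f,\cdot)$ of $D[0,1]$, the space of càdlàg functions with the Skorohod metric) converge weakly to a (standard) Brownian motion process in the corresponding space. For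 sub-$\sigma$-algebras $\mathcal A,\mathcal B$ of $\mathcal F$, $\beta(\mathcal A,\mathcal B):=\frac12\sup\sum_{i=1}^I\sum_{j=1}^J|\mu(A_i\cap B_j)-\mu(A_i)\mu(B_j)|$, the supremum being over finite partitions $\{A_i\}$, $\{B_j\}$ of $\Omega$ into elements of $\mathcal A$, respectively $\mathcal B$. For a strictly stationary sequence $X=(X_k)_{k\in\mathbb Z}$ and $n\geqslant 0$, $\beta_X(n):=\beta(\sigma(X_k,k\leqslant 0),\sigma(X_k,k\geqslant n))$; here $Y$ is indexed by $\mathbb Z$ via $Y_k=f\circ T^k$. For sequences of positive reals, $a_N\asymp b_N$ means there is $C>0$ with $C^{-1}a_N\leqslant b_N\leqslant Ca_N$ for all $N\geqslant 1$. *)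

theory Defs
  imports "HOL-Probability.Probability"
begin

section \<open>Invertible measure preserving maps and their partial sums\<close>

definition measure_automorphism :: "'a measure \<Rightarrow> ('a \<Rightarrow> 'a) \<Rightarrow> bool" where
  "measure_automorphism M T \<longleftrightarrow>
     bij_betw T (space M) (space M) \<and>
     T \<in> M \<rightarrow>\<^sub>M M \<and>
     the_inv_into (space M) T \<in> M \<rightarrow>\<^sub>M M \<and>
     distr M M T = M"

text \<open>The two-sided iterates are meaningful on \<^term>\<open>space M\<close>, where \<open>T\<close> is bijective.\<close>

definition int_iterate :: "'a measure \<Rightarrow> ('a \<Rightarrow> 'a) \<Rightarrow> int \<Rightarrow> 'a \<Rightarrow> 'a" where
  "int_iterate M T k =
     (if k \<ge> 0 then T ^^ nat k else the_inv_into (space M) T ^^ nat (- k))"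

definition partial_sum :: "('a \<Rightarrow> 'a) \<Rightarrow> ('a \<Rightarrow> real) \<Rightarrow> nat \<Rightarrow> 'a \<Rightarrow> real" where
  "partial_sum T f n \<omega> = (\<Sum>j<n. f ((T ^^ j) \<omega>))"

definition sum_variance :: "'a measure \<Rightarrow> ('a \<Rightarrow> 'a) \<Rightarrow> ('a \<Rightarrow> real) \<Rightarrow> nat \<Rightarrow> real" where
  "sum_variance M T f n = (\<integral>\<omega>. (partial_sum T f n \<omega>)\<^sup>2 \<partial>M)"

definition polygonal_sum :: "('a \<Rightarrow> 'a) \<Rightarrow> ('a \<Rightarrow> real) \<Rightarrow> nat \<Rightarrow> real \<Rightarrow> 'a \<Rightarrow> real" where
  "polygonal_sum T f n t \<omega> =
     partial_sum T f (nat \<lfloor>real n * t\<rfloor>) \<omega> +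
     (real n * t - \<lfloor>real n * t\<rfloor>) * f ((T ^^ nat \<lfloor>real n * t\<rfloor>) \<omega>)"

definition step_sum :: "('a \<Rightarrow> 'a) \<Rightarrow> ('a \<Rightarrow> real) \<Rightarrow> nat \<Rightarrow> real \<Rightarrow> 'a \<Rightarrow> real" where
  "step_sum T f n t \<omega> = partial_sum T f (nat \<lfloor>real n * t\<rfloor>) \<omega>"

definition same_order :: "(nat \<Rightarrow> real) \<Rightarrow> (nat \<Rightarrow> real) \<Rightarrow> bool" where
  "same_order a b \<longleftrightarrow> (\<exists>C>0. \<forall>N\<ge>1. inverse C * a N \<le> b N \<and> b N \<le> C * a N)"


section \<open>Absolute regularity\<close>

text \<open>The value is a genuine supremum, see \<open>beta_coeff_bdd_above\<close> below. Partitions in the sense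
  of \<^const>\<open>partition_on\<close> have no empty blocks, which does not change the sums.\<close>

definition beta_coeff :: "'a measure \<Rightarrow> 'a set set \<Rightarrow> 'a set set \<Rightarrow> real" where
  "beta_coeff M \<A> \<B> =
     1 / 2 * (SUP (P, Q) \<in> {P. finite P \<and> partition_on (space M) P \<and> P \<subseteq> \<A>} \<times>
                           {Q. finite Q \<and> partition_on (space M) Q \<and> Q \<subseteq> \<B>}.
                \<Sum>A\<in>P. \<Sum>B\<in>Q. \<bar>measure M (A \<inter> B) - measure M A * measure M B\<bar>)"

definition generated_sigma :: "'a measure \<Rightarrow> (int \<Rightarrow> 'a \<Rightarrow> real) \<Rightarrow> int set \<Rightarrow> 'a set set" where
  "generated_sigma M X K =
     sigma_sets (space M) (\<Union>k\<in>K. {X k -` B \<inter> space M | B. B \<in> sets borel})"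

definition beta_mixing :: "'a measure \<Rightarrow> (int \<Rightarrow> 'a \<Rightarrow> real) \<Rightarrow> nat \<Rightarrow> real" where
  "beta_mixing M X n = beta_coeff M (generated_sigma M X {..0}) (generated_sigma M X {int n..})"


section \<open>Weak convergence in a metric space\<close>

definition metric_borel :: "'b metric \<Rightarrow> 'b measure" where
  "metric_borel m = sigma (mspace m) {U. openin (mtopology_of m) U}"

definition weak_conv_metric :: "'b metric \<Rightarrow> (nat \<Rightarrow> 'b measure) \<Rightarrow> 'b measure \<Rightarrow> bool" where
  "weak_conv_metric m \<nu> \<nu>' \<longleftrightarrow>
     (\<forall>h. continuous_map (mtopology_of m) euclideanreal h \<and> bounded (h ` mspace m) \<longrightarrow>
        (\<lambda>n. \<integral>x. h x \<partial>\<nu> n) \<longlonglongrightarrow> (\<integral>x. h x \<partial>\<nu>'))"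


section \<open>The path spaces\<close>

text \<open>Paths are functions on the reals that are \<^const>\<open>undefined\<close> outside the unit interval, as in
  \<^const>\<open>cfunspace\<close>, whose distance is the supremum distance.\<close>

definition C01 :: "(real \<Rightarrow> real) metric" where
  "C01 = cfunspace (top_of_set {0..1}) euclidean_metric"

definition cadlag01 :: "(real \<Rightarrow> real) set" where
  "cadlag01 = {x \<in> extensional {0..1}.
     (\<forall>t\<in>{0..<1}. (x \<longlongrightarrow> x t) (at_right t)) \<and>
     (\<forall>t\<in>{0<..1}. \<exists>l. (x \<longlongrightarrow> l) (at_left t))}"

definition time_changes :: "(real \<Rightarrow> real) set" where
  "time_changes = {l. strict_mono_on {0..1} l \<and> continuous_on {0..1} l \<and> l ` {0..1} = {0..1}}"

definition skorohod_dist :: "(real \<Rightarrow> real) \<Rightarrow> (real \<Rightarrow> real) \<Rightarrow> real" where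
  "skorohod_dist x y =
     (if x \<in> cadlag01 \<and> y \<in> cadlag01
      then Inf {e. e > 0 \<and>
             (\<exists>l\<in>time_changes. \<forall>t\<in>{0..1}. \<bar>l t - t\<bar> \<le> e \<and> \<bar>x t - y (l t)\<bar> \<le> e)}
      else 0)"

text \<open>\<^const>\<open>skorohod_dist\<close> is a metric on \<^const>\<open>cadlag01\<close>, see \<open>Metric_space_skorohod\<close> below;
  the value off \<^const>\<open>cadlag01\<close> is irrelevant.\<close>

definition D01 :: "(real \<Rightarrow> real) metric" where
  "D01 = metric (cadlag01, skorohod_dist)"


section \<open>Brownian motion and the limit theorems\<close>

definition standard_brownian_motion :: "'b measure \<Rightarrow> (real \<Rightarrow> 'b \<Rightarrow> real) \<Rightarrow> bool" where
  "standard_brownian_motion N B \<longleftrightarrow>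
     prob_space N \<and>
     (\<forall>t\<in>{0..1}. B t \<in> borel_measurable N) \<and>
     (AE \<omega> in N. B 0 \<omega> = 0) \<and>
     (\<forall>n (t :: nat \<Rightarrow> real). (\<forall>i\<le>n. t i \<in> {0..1}) \<and> (\<forall>i<n. t i \<le> t (Suc i)) \<longrightarrow>
        prob_space.indep_vars N (\<lambda>_. borel) (\<lambda>i \<omega>. B (t (Suc i)) \<omega> - B (t i) \<omega>) {..<n}) \<and>
     (\<forall>s t. 0 \<le> s \<and> s < t \<and> t \<le> 1 \<longrightarrow>
        distributed N lborel (\<lambda>\<omega>. B t \<omega> - B s \<omega>) (normal_density 0 (sqrt (t - s)))) \<and>
     (AE \<omega> in N. continuous_on {0..1} (\<lambda>t. B t \<omega>))"

text \<open>The law of Brownian motion on a path space: the coordinate process is a Brownian motion.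
  This determines the measure, so the existential quantifiers in \<open>wip_C\<close> and \<open>wip_D\<close> below
  merely name Wiener measure.\<close>

definition brownian_law :: "(real \<Rightarrow> real) metric \<Rightarrow> (real \<Rightarrow> real) measure \<Rightarrow> bool" where
  "brownian_law m W \<longleftrightarrow>
     sets W = sets (metric_borel m) \<and> standard_brownian_motion W (\<lambda>t x. x t)"

definition clt_holds ::
  "'a measure \<Rightarrow> ('a \<Rightarrow> 'a) \<Rightarrow> ('a \<Rightarrow> real) \<Rightarrow> (nat \<Rightarrow> real) \<Rightarrow> bool" where
  "clt_holds M T f a \<longleftrightarrow>
     weak_conv_m (\<lambda>n. distr M borel (\<lambda>\<omega>. partial_sum T f n \<omega> / a n)) std_normal_distribution"

definition polygonal_path ::
  "('a \<Rightarrow> 'a) \<Rightarrow> ('a \<Rightarrow> real) \<Rightarrow> (nat \<Rightarrow> real) \<Rightarrow> nat \<Rightarrow> 'a \<Rightarrow> real \<Rightarrow> real" where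
  "polygonal_path T f a n \<omega> = (\<lambda>t\<in>{0..1}. polygonal_sum T f n t \<omega> / a n)"

definition step_path ::
  "('a \<Rightarrow> 'a) \<Rightarrow> ('a \<Rightarrow> real) \<Rightarrow> (nat \<Rightarrow> real) \<Rightarrow> nat \<Rightarrow> 'a \<Rightarrow> real \<Rightarrow> real" where
  "step_path T f a n \<omega> = (\<lambda>t\<in>{0..1}. step_sum T f n t \<omega> / a n)"

text \<open>The paths above are random elements of the respective spaces, see
  \<open>polygonal_path_measurable\<close> and \<open>step_path_measurable\<close> below, so the laws are not degenerate.\<close>

definition wip_C ::
  "'a measure \<Rightarrow> ('a \<Rightarrow> 'a) \<Rightarrow> ('a \<Rightarrow> real) \<Rightarrow> (nat \<Rightarrow> real) \<Rightarrow> bool" where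
  "wip_C M T f a \<longleftrightarrow>
     (\<exists>W. brownian_law C01 W \<and>
        weak_conv_metric C01 (\<lambda>n. distr M (metric_borel C01) (polygonal_path T f a n)) W)"

definition wip_D ::
  "'a measure \<Rightarrow> ('a \<Rightarrow> 'a) \<Rightarrow> ('a \<Rightarrow> real) \<Rightarrow> (nat \<Rightarrow> real) \<Rightarrow> bool" where
  "wip_D M T f a \<longleftrightarrow>
     (\<exists>W. brownian_law D01 W \<and>
        weak_conv_metric D01 (\<lambda>n. distr M (metric_borel D01) (step_path T f a n)) W)"


section \<open>Well-definedness\<close>

lemma beta_coeff_bdd_above:
  assumes "prob_space M" "\<A> \<subseteq> sets M" "\<B> \<subseteq> sets M"
  shows "bdd_above ((\<lambda>(P, Q). \<Sum>A\<in>P. \<Sum>B\<in>Q. \<bar>measure M (A \<inter> B) - measure M A * measure M B\<bar>) `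
           ({P. finite P \<and> partition_on (space M) P \<and> P \<subseteq> \<A>} \<times>
            {Q. finite Q \<and> partition_on (space M) Q \<and> Q \<subseteq> \<B>}))"
proof -
  interpret prob_space M by fact
  have total: "(\<Sum>B\<in>Q. measure M (A \<inter> B)) = measure M A"
    if "finite Q" "partition_on (space M) Q" "Q \<subseteq> sets M" "A \<in> sets M" for A Q
  proof -
    have "measure M (\<Union>B\<in>Q. A \<inter> B) = (\<Sum>B\<in>Q. measure M (A \<inter> B))"
    proof (rule finite_measure_finite_Union)
      show "disjoint_family_on (\<lambda>B. A \<inter> B) Q"
        using that unfolding disjoint_family_on_def partition_on_def pairwise_def disjnt_def by blast
    qed (use that in auto)
    moreover have "(\<Union>B\<in>Q. A \<inter> B) = A"
      using that sets.sets_into_space[of A M] by (auto simp: partition_on_def)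
    ultimately show ?thesis by simp
  qed
  have total1: "(\<Sum>B\<in>Q. measure M B) = 1"
    if "finite Q" "partition_on (space M) Q" "Q \<subseteq> sets M" for Q
  proof -
    have "space M \<inter> B = B" if "B \<in> Q" for B
      using that \<open>Q \<subseteq> sets M\<close> sets.sets_into_space by blast
    then show ?thesis
      using total[OF that, of "space M"] by (simp add: prob_space)
  qed
  show ?thesis
  proof (rule bdd_aboveI[where M = 2], clarsimp)
    fix P Q
    assume P: "finite P" "partition_on (space M) P" "P \<subseteq> \<A>"
      and Q: "finite Q" "partition_on (space M) Q" "Q \<subseteq> \<B>"
    have PQ: "P \<subseteq> sets M" "Q \<subseteq> sets M" using P Q assms by auto
    have "(\<Sum>A\<in>P. \<Sum>B\<in>Q. \<bar>measure M (A \<inter> B) - measure M A * measure M B\<bar>)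
        \<le> (\<Sum>A\<in>P. \<Sum>B\<in>Q. measure M (A \<inter> B) + measure M A * measure M B)"
      by (intro sum_mono) (auto simp: abs_le_iff intro: add_nonneg_nonneg)
    also have "\<dots> = (\<Sum>A\<in>P. measure M A + measure M A * 1)"
    proof (rule sum.cong[OF refl])
      fix A assume "A \<in> P"
      then have "A \<in> sets M" using PQ by auto
      then show "(\<Sum>B\<in>Q. measure M (A \<inter> B) + measure M A * measure M B)
          = measure M A + measure M A * 1"
        using total[OF Q(1,2) PQ(2)] total1[OF Q(1,2) PQ(2)]
        by (simp add: sum.distrib flip: sum_distrib_left)
    qed
    also have "\<dots> = 2"
      using total1[OF P(1,2) PQ(1)] by (simp flip: sum_distrib_left)
    finally show "(\<Sum>A\<in>P. \<Sum>B\<in>Q. \<bar>measure M (A \<inter> B) - measure M A * measure M B\<bar>) \<le> 2" .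
  qed
qed

lemma cadlag01_bounded:
  assumes x: "x \<in> cadlag01"
  obtains K where "\<And>t. t \<in> {0..1} \<Longrightarrow> \<bar>x t\<bar> \<le> K"
proof -
  have "bounded (x ` ({0..1} \<inter> {0..1}))"
  proof (rule Bolzano[where P = "\<lambda>a b. bounded (x ` ({a..b} \<inter> {0..1}))"])
    fix a b c :: real
    assume *: "bounded (x ` ({a..b} \<inter> {0..1}))" "bounded (x ` ({b..c} \<inter> {0..1}))" "a \<le> b" "b \<le> c"
    have "{a..c} \<inter> {0..1} = ({a..b} \<inter> {0..1}) \<union> ({b..c} \<inter> {0..1})"
      using *(3,4) by auto
    then show "bounded (x ` ({a..c} \<inter> {0..1}))"
      using *(1,2) by (simp only: image_Un bounded_Un simp_thms)
  next
    fix t :: real assume t: "0 \<le> t" "t \<le> 1"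
    have "\<exists>d>0. \<exists>K. \<forall>s. t < s \<and> s < t + d \<and> s \<le> 1 \<longrightarrow> \<bar>x s\<bar> \<le> K"
    proof (cases "t < 1")
      case True
      then have "(x \<longlongrightarrow> x t) (at_right t)" using x t by (auto simp: cadlag01_def)
      from tendstoD[OF this, of 1] obtain b where "b > t" "\<forall>s. t < s \<and> s < b \<longrightarrow> dist (x s) (x t) < 1"
        by (auto simp: eventually_at_right_field)
      then show ?thesis
        by (intro exI[of _ "b - t"] exI[of _ "\<bar>x t\<bar> + 1"] conjI) (auto simp: dist_real_def)
    qed (auto intro!: exI[of _ 1])
    then obtain d1 K1 where 1: "d1 > 0" "\<forall>s. t < s \<and> s < t + d1 \<and> s \<le> 1 \<longrightarrow> \<bar>x s\<bar> \<le> K1" by blast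
    have "\<exists>d>0. \<exists>K. \<forall>s. s < t \<and> t - d < s \<and> 0 \<le> s \<longrightarrow> \<bar>x s\<bar> \<le> K"
    proof (cases "t > 0")
      case True
      then have "t \<in> {0<..1}" using t by auto
      then obtain l where "(x \<longlongrightarrow> l) (at_left t)" using x unfolding cadlag01_def by blast
      from tendstoD[OF this, of 1] obtain b where "b < t" "\<forall>s. b < s \<and> s < t \<longrightarrow> dist (x s) l < 1"
        by (auto simp: eventually_at_left_field)
      then show ?thesis
        by (intro exI[of _ "t - b"] exI[of _ "\<bar>l\<bar> + 1"] conjI) (auto simp: dist_real_def)
    qed (auto intro!: exI[of _ 1])
    then obtain d2 K2 where 2: "d2 > 0" "\<forall>s. s < t \<and> t - d2 < s \<and> 0 \<le> s \<longrightarrow> \<bar>x s\<bar> \<le> K2" by blast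
    show "\<exists>d>0. \<forall>a b. a \<le> t \<and> t \<le> b \<and> b - a < d \<longrightarrow> bounded (x ` ({a..b} \<inter> {0..1}))"
    proof (intro exI[of _ "min d1 d2"] conjI allI impI)
      fix a b :: real assume ab: "a \<le> t \<and> t \<le> b \<and> b - a < min d1 d2"
      have "\<bar>x s\<bar> \<le> max \<bar>x t\<bar> (max K1 K2)" if "s \<in> {a..b} \<inter> {0..1}" for s
      proof (cases s t rule: linorder_cases)
        case less
        then show ?thesis using that ab 2(2)[rule_format, of s] by auto
      next
        case greater
        then show ?thesis using that ab 1(2)[rule_format, of s] by auto
      qed auto
      then show "bounded (x ` ({a..b} \<inter> {0..1}))"
        unfolding bounded_iff by (intro exI[of _ "max \<bar>x t\<bar> (max K1 K2)"]) auto
    qed (use 1 2 in auto)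
  qed simp
  then obtain K where "\<forall>y\<in>x ` {0..1}. \<bar>y\<bar> \<le> K" by (auto simp: bounded_iff)
  then show ?thesis by (intro that[of K]) blast
qed

lemma time_changes_id: "(\<lambda>t. t) \<in> time_changes"
  by (auto simp: time_changes_def strict_mono_on_def)

lemma time_changes_comp:
  assumes "l \<in> time_changes" "l' \<in> time_changes"
  shows "l' \<circ> l \<in> time_changes"
  unfolding time_changes_def
proof (intro CollectI conjI)
  show "strict_mono_on {0..1} (l' \<circ> l)"
  proof (rule strict_mono_onI)
    fix r s :: real assume rs: "r \<in> {0..1}" "s \<in> {0..1}" "r < s"
    have "l r \<in> {0..1}" "l s \<in> {0..1}" using assms(1) rs by (auto simp: time_changes_def)
    moreover have "l r < l s"
      using assms(1) strict_mono_onD[of "{0..1}" l, OF _ rs] by (simp add: time_changes_def)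
    ultimately show "(l' \<circ> l) r < (l' \<circ> l) s"
      using assms(2) strict_mono_onD[of "{0..1}" l' "l r" "l s"] by (simp add: time_changes_def)
  qed
  show "continuous_on {0..1} (l' \<circ> l)"
    using assms by (intro continuous_on_compose) (auto simp: time_changes_def)
  show "(l' \<circ> l) ` {0..1} = {0..1}"
    using assms unfolding image_comp[symmetric] time_changes_def by simp
qed

lemma time_changes_inverse:
  assumes l: "l \<in> time_changes"
  obtains l' where "l' \<in> time_changes" "\<And>t. t \<in> {0..1} \<Longrightarrow> l (l' t) = t"
proof
  define l' where "l' = the_inv_into {0..1} l"
  have mono: "strict_mono_on {0..1} l" and cont: "continuous_on {0..1} l"
    and img: "l ` {0..1} = {0..1}" using l by (auto simp: time_changes_def)
  have inj: "inj_on l {0..1}" using mono by (rule strict_mono_on_imp_inj_on)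
  have right: "l (l' t) = t" if "t \<in> {0..1}" for t
    using f_the_inv_into_f[OF inj] that img unfolding l'_def by blast
  have ran: "l' t \<in> {0..1}" if "t \<in> {0..1}" for t
    using the_inv_into_into[OF inj _ order_refl] that img unfolding l'_def by blast
  have left: "l' (l t) = t" if "t \<in> {0..1}" for t
    using the_inv_into_f_f[OF inj that] unfolding l'_def .
  show "l (l' t) = t" if "t \<in> {0..1}" for t by (rule right) fact
  have "strict_mono_on {0..1} l'"
  proof (rule strict_mono_onI)
    fix r s :: real assume rs: "r \<in> {0..1}" "s \<in> {0..1}" "r < s"
    show "l' r < l' s"
    proof (rule ccontr)
      assume "\<not> l' r < l' s"
      then have "l (l' s) \<le> l (l' r)"
        using strict_mono_on_leD[OF mono ran[OF rs(2)] ran[OF rs(1)]] by auto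
      then show False using right rs by auto
    qed
  qed
  moreover have "continuous_on {0..1} l'"
    using continuous_on_inv[OF cont compact_Icc] left img by metis
  moreover have "l' ` {0..1} = {0..1}"
  proof
    show "l' ` {0..1} \<subseteq> {0..1}" using ran by blast
    show "{0..1} \<subseteq> l' ` {0..1}"
    proof
      fix t :: real assume "t \<in> {0..1}"
      then have "l t \<in> {0..1}" "l' (l t) = t" using img left by auto
      then show "t \<in> l' ` {0..1}" by (metis imageI)
    qed
  qed
  ultimately show "l' \<in> time_changes" by (simp add: time_changes_def)
qed

lemma time_changes_1:
  assumes "l \<in> time_changes"
  shows "l 1 = 1"
proof -
  have mono: "strict_mono_on {0..1} l" and img: "l ` {0..1} = {0..1}"
    using assms by (auto simp: time_changes_def)
  have "1 \<in> l ` {0..1}" using img by auto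
  then obtain t where t: "t \<in> {0..1}" "l t = 1" by auto
  have "l t \<le> l 1" using strict_mono_on_leD[OF mono t(1)] t by auto
  moreover have "l 1 \<in> {0..1}" using img by auto
  ultimately show ?thesis using t by auto
qed

definition skorohod_near :: "(real \<Rightarrow> real) \<Rightarrow> (real \<Rightarrow> real) \<Rightarrow> real set" where
  "skorohod_near x y =
     {e. e > 0 \<and> (\<exists>l\<in>time_changes. \<forall>t\<in>{0..1}. \<bar>l t - t\<bar> \<le> e \<and> \<bar>x t - y (l t)\<bar> \<le> e)}"

lemma skorohod_dist_near:
  "x \<in> cadlag01 \<Longrightarrow> y \<in> cadlag01 \<Longrightarrow> skorohod_dist x y = Inf (skorohod_near x y)"
  by (simp add: skorohod_dist_def skorohod_near_def)

lemma skorohod_near_bdd: "bdd_below (skorohod_near x y)"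
  by (rule bdd_belowI[of _ 0]) (auto simp: skorohod_near_def)

lemma skorohod_near_nonempty:
  assumes "x \<in> cadlag01" "y \<in> cadlag01"
  shows "skorohod_near x y \<noteq> {}"
proof -
  obtain K where K: "\<And>t. t \<in> {0..1} \<Longrightarrow> \<bar>x t\<bar> \<le> K" using cadlag01_bounded assms by metis
  obtain L where L: "\<And>t. t \<in> {0..1} \<Longrightarrow> \<bar>y t\<bar> \<le> L" using cadlag01_bounded assms by metis
  have "0 \<le> K" "0 \<le> L" using K[of 0] L[of 0] by auto
  moreover have "\<bar>x t - y t\<bar> \<le> K + L + 1" if "t \<in> {0..1}" for t
    using K[OF that] L[OF that] by auto
  ultimately have "K + L + 1 \<in> skorohod_near x y"
    unfolding skorohod_near_def using time_changes_id
    by (auto intro!: bexI[of _ "\<lambda>t. t"])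
  then show ?thesis by auto
qed

lemma skorohod_near_sym: "skorohod_near x y \<subseteq> skorohod_near y x"
proof
  fix e assume "e \<in> skorohod_near x y"
  then obtain l where e: "e > 0" and l: "l \<in> time_changes"
    and le: "\<And>t. t \<in> {0..1} \<Longrightarrow> \<bar>l t - t\<bar> \<le> e \<and> \<bar>x t - y (l t)\<bar> \<le> e"
    by (auto simp: skorohod_near_def)
  obtain l' where l': "l' \<in> time_changes" and inv: "\<And>t. t \<in> {0..1} \<Longrightarrow> l (l' t) = t"
    using time_changes_inverse[OF l] by metis
  have "\<bar>l' t - t\<bar> \<le> e \<and> \<bar>y t - x (l' t)\<bar> \<le> e" if t: "t \<in> {0..1}" for t
  proof -
    have "l' t \<in> {0..1}" using l' t by (auto simp: time_changes_def)
    then show ?thesis using le[of "l' t"] inv[OF t] by (simp add: abs_minus_commute)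
  qed
  then show "e \<in> skorohod_near y x" using e l' unfolding skorohod_near_def by blast
qed

lemma skorohod_near_triangle:
  assumes "d \<in> skorohod_near x y" "e \<in> skorohod_near y z"
  shows "d + e \<in> skorohod_near x z"
proof -
  obtain l where d: "d > 0" and l: "l \<in> time_changes"
    and ld: "\<And>t. t \<in> {0..1} \<Longrightarrow> \<bar>l t - t\<bar> \<le> d \<and> \<bar>x t - y (l t)\<bar> \<le> d"
    using assms by (auto simp: skorohod_near_def)
  obtain l' where e: "e > 0" and l': "l' \<in> time_changes"
    and le: "\<And>t. t \<in> {0..1} \<Longrightarrow> \<bar>l' t - t\<bar> \<le> e \<and> \<bar>y t - z (l' t)\<bar> \<le> e"
    using assms by (auto simp: skorohod_near_def)
  have "\<bar>(l' \<circ> l) t - t\<bar> \<le> d + e \<and> \<bar>x t - z ((l' \<circ> l) t)\<bar> \<le> d + e" if t: "t \<in> {0..1}" for t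
  proof -
    have "l t \<in> {0..1}" using l t by (auto simp: time_changes_def)
    from le[OF this] ld[OF t] show ?thesis by (auto simp: abs_le_iff)
  qed
  then show ?thesis
    using add_pos_pos[OF d e] time_changes_comp[OF l l'] unfolding skorohod_near_def by blast
qed

lemma skorohod_dist_zeroD:
  assumes x: "x \<in> cadlag01" and y: "y \<in> cadlag01" and 0: "skorohod_dist x y = 0"
  shows "x = y"
proof -
  have near: "\<exists>l\<in>time_changes. \<forall>t\<in>{0..1}. \<bar>l t - t\<bar> < e \<and> \<bar>x t - y (l t)\<bar> < e" if "e > 0" for e
  proof -
    have "Inf (skorohod_near x y) < e" using 0 that by (simp add: skorohod_dist_near[OF x y])
    from cInf_lessD[OF skorohod_near_nonempty[OF x y] this]
    obtain d where d: "d \<in> skorohod_near x y" "d < e" by blast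
    then obtain l where "l \<in> time_changes"
      "\<forall>t\<in>{0..1}. \<bar>l t - t\<bar> \<le> d \<and> \<bar>x t - y (l t)\<bar> \<le> d" by (auto simp: skorohod_near_def)
    then show ?thesis using d(2) by (blast intro: le_less_trans)
  qed
  have eq: "x t = y t" if t: "t \<in> {0..1}" for t
  proof -
    have "\<bar>x t - y t\<bar> \<le> e" if e: "e > 0" for e
    proof (cases "t = 1")
      case True
      from near[OF e] obtain l where "l \<in> time_changes" "\<bar>x 1 - y (l 1)\<bar> < e" by force
      then show ?thesis using True time_changes_1[of l] by auto
    next
      case False
      then have lim: "(x \<longlongrightarrow> x t) (at_right t)" "(y \<longlongrightarrow> y t) (at_right t)" and t1: "t < 1"
        using x y t by (auto simp: cadlag01_def)
      from tendstoD[OF lim(1), of "e / 3"] e obtain b1 where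
        b1: "b1 > t" "\<And>s. t < s \<Longrightarrow> s < b1 \<Longrightarrow> \<bar>x s - x t\<bar> < e / 3"
        by (auto simp: eventually_at_right_field dist_real_def)
      from tendstoD[OF lim(2), of "e / 3"] e obtain b2 where
        b2: "b2 > t" "\<And>s. t < s \<Longrightarrow> s < b2 \<Longrightarrow> \<bar>y s - y t\<bar> < e / 3"
        by (auto simp: eventually_at_right_field dist_real_def)
      define g where "g = min 1 (min b1 b2) - t"
      have g: "g > 0" "t + g \<le> 1" "t + g \<le> b1" "t + g \<le> b2"
        using b1 b2 t1 by (auto simp: g_def)
      define s where "s = t + g / 2"
      have s: "s \<in> {0..1}" "t < s" "s < b1" using g t by (auto simp: s_def)
      have "min (g / 4) (e / 3) > 0" using g e by auto
      from near[OF this] s(1) obtain l where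
        l: "\<bar>l s - s\<bar> < g / 4" "\<bar>x s - y (l s)\<bar> < e / 3" by force
      have "t < l s" "l s < b2" using l(1) g unfolding s_def by linarith+
      then show ?thesis using b1(2)[OF s(2,3)] b2(2)[of "l s"] l(2) by linarith
    qed
    then have "\<bar>x t - y t\<bar> \<le> 0" by (rule field_le_epsilon) auto
    then show ?thesis by simp
  qed
  show ?thesis
    using x y eq by (intro extensionalityI[of x "{0..1}" y]) (auto simp: cadlag01_def)
qed

lemma skorohod_dist_le:
  assumes "e \<ge> 0" "\<And>t. t \<in> {0..1} \<Longrightarrow> \<bar>x t - y t\<bar> \<le> e"
  shows "skorohod_dist x y \<le> e"
proof (cases "x \<in> cadlag01 \<and> y \<in> cadlag01")
  case True
  show ?thesis
  proof (rule field_le_epsilon)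
    fix d :: real assume "d > 0"
    moreover have "\<bar>x t - y t\<bar> \<le> e + d" if "t \<in> {0..1}" for t
      using assms(2)[OF that] \<open>d > 0\<close> by linarith
    ultimately have "e + d \<in> skorohod_near x y"
      using assms(1) time_changes_id unfolding skorohod_near_def
      by (auto intro!: bexI[of _ "\<lambda>t. t"])
    then show "skorohod_dist x y \<le> e + d"
      using True by (simp add: skorohod_dist_near cInf_lower[OF _ skorohod_near_bdd])
  qed
qed (use assms(1) in \<open>auto simp: skorohod_dist_def\<close>)

lemma Metric_space_skorohod: "Metric_space cadlag01 skorohod_dist"
proof
  fix x y
  show nonneg: "0 \<le> skorohod_dist x y" for x y
  proof (cases "x \<in> cadlag01 \<and> y \<in> cadlag01")
    case True
    have "0 \<le> Inf (skorohod_near x y)"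
      using True by (intro cInf_greatest skorohod_near_nonempty) (auto simp: skorohod_near_def)
    then show ?thesis using True by (simp add: skorohod_dist_near)
  qed (auto simp: skorohod_dist_def)
  have "skorohod_near x y = skorohod_near y x"
    using skorohod_near_sym by (intro subset_antisym)
  then show "skorohod_dist x y = skorohod_dist y x"
    unfolding skorohod_dist_def skorohod_near_def by simp
  assume xy: "x \<in> cadlag01" "y \<in> cadlag01"
  have "skorohod_dist x x \<le> 0" by (rule skorohod_dist_le) auto
  with nonneg[of x x] show "skorohod_dist x y = 0 \<longleftrightarrow> x = y"
    using skorohod_dist_zeroD[OF xy] by auto
next
  fix x y z assume xyz: "x \<in> cadlag01" "y \<in> cadlag01" "z \<in> cadlag01"
  have 1: "skorohod_dist x z - e \<le> skorohod_dist x y" if e: "e \<in> skorohod_near y z" for e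
    unfolding skorohod_dist_near[OF xyz(1,2)]
  proof (rule cInf_greatest[OF skorohod_near_nonempty[OF xyz(1,2)]])
    fix d assume "d \<in> skorohod_near x y"
    from skorohod_near_triangle[OF this e] have "skorohod_dist x z \<le> d + e"
      unfolding skorohod_dist_near[OF xyz(1,3)] by (rule cInf_lower[OF _ skorohod_near_bdd])
    then show "skorohod_dist x z - e \<le> d" by simp
  qed
  have "skorohod_dist x z - skorohod_dist x y \<le> skorohod_dist y z"
    unfolding skorohod_dist_near[OF xyz(2,3)]
  proof (rule cInf_greatest[OF skorohod_near_nonempty[OF xyz(2,3)]])
    fix e assume "e \<in> skorohod_near y z"
    from 1[OF this] show "skorohod_dist x z - skorohod_dist x y \<le> e" by simp
  qed
  then show "skorohod_dist x z \<le> skorohod_dist x y + skorohod_dist y z" by simp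
qed

lemma mspace_D01 [simp]: "mspace D01 = cadlag01"
  and mdist_D01 [simp]: "mdist D01 = skorohod_dist"
  unfolding D01_def
  using Metric_space.mspace_metric[OF Metric_space_skorohod]
    Metric_space.mdist_metric[OF Metric_space_skorohod] by auto

lemma mspace_C01:
  "x \<in> mspace C01 \<longleftrightarrow> x \<in> extensional {0..1} \<and> continuous_on {0..1} x"
proof -
  have "Met_TC.mbounded (x ` {0..1})" if "continuous_on {0..1} x"
    using compact_imp_bounded[OF compact_continuous_image[OF that compact_Icc]]
    by (simp add: Met_TC.mbounded_def bounded_subset_cball)
  then show ?thesis by (auto simp: C01_def)
qed

lemma mdist_C01_le:
  assumes "B \<ge> 0" "\<And>t. t \<in> {0..1} \<Longrightarrow> \<bar>x t - y t\<bar> \<le> B"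
  shows "mdist C01 x y \<le> B"
  unfolding C01_def using assms by (intro mdist_cfunspace_le) (auto simp: dist_real_def)

lemma measurable_into_metric:
  fixes Z :: "'a \<Rightarrow> nat \<Rightarrow> real" and \<Phi> :: "(nat \<Rightarrow> real) \<Rightarrow> 'b"
  assumes Z: "\<And>i. (\<lambda>\<omega>. Z \<omega> i) \<in> borel_measurable M"
    and mem: "\<And>v. \<Phi> v \<in> mspace m"
    and lip: "\<And>v w. mdist m (\<Phi> v) (\<Phi> w) \<le> c * (\<Sum>i<k. \<bar>v i - w i\<bar>)"
  shows "(\<lambda>\<omega>. \<Phi> (Z \<omega>)) \<in> M \<rightarrow>\<^sub>M metric_borel m"
proof -
  interpret m: Metric_space "mspace m" "mdist m" by simp
  have "\<Phi> \<in> borel \<rightarrow>\<^sub>M metric_borel m"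
    unfolding metric_borel_def
  proof (rule measurable_measure_of)
    show "{U. openin (mtopology_of m) U} \<subseteq> Pow (mspace m)"
      using openin_subset by fastforce
    show "\<Phi> \<in> space borel \<rightarrow> mspace m" using mem by auto
    fix U assume "U \<in> {U. openin (mtopology_of m) U}"
    then have U: "openin m.mtopology U" by (simp add: mtopology_of_def)
    have "open (\<Phi> -` U)"
    proof (subst open_subopen, intro ballI)
      fix v assume "v \<in> \<Phi> -` U"
      then obtain r where r: "r > 0" "m.mball (\<Phi> v) r \<subseteq> U"
        using U by (auto simp: m.openin_mtopology)
      define V where "V = {w. c * (\<Sum>i<k. \<bar>v i - w i\<bar>) < r}"
      have "open V" unfolding V_def
        by (intro open_Collect_less continuous_intros continuous_on_product_coordinates)
      moreover have "v \<in> V" using r by (simp add: V_def)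
      moreover have "V \<subseteq> \<Phi> -` U"
        using r(2) mem lip unfolding V_def by (fastforce intro: le_less_trans)
      ultimately show "\<exists>T. open T \<and> v \<in> T \<and> T \<subseteq> \<Phi> -` U" by blast
    qed
    then show "\<Phi> -` U \<inter> space borel \<in> sets borel" by simp
  qed
  moreover have "Z \<in> borel_measurable M"
    using Z by (rule measurable_coordinatewise_then_product)
  ultimately show ?thesis by (rule measurable_compose[rotated])
qed

definition step_fun :: "nat \<Rightarrow> real \<Rightarrow> (nat \<Rightarrow> real) \<Rightarrow> real \<Rightarrow> real" where
  "step_fun n a v = (\<lambda>t\<in>{0..1}. (\<Sum>j<nat \<lfloor>real n * t\<rfloor>. v j) / a)"

definition polygonal_fun :: "nat \<Rightarrow> real \<Rightarrow> (nat \<Rightarrow> real) \<Rightarrow> real \<Rightarrow> real" where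
  "polygonal_fun n a v = (\<lambda>t\<in>{0..1}. (\<Sum>j<n. min 1 (max 0 (real n * t - real j)) * v j) / a)"

lemma step_fun_cadlag: "step_fun n a v \<in> cadlag01"
proof -
  have right: "(step_fun n a v \<longlongrightarrow> step_fun n a v t) (at_right t)" if t: "0 \<le> t" "t < 1" for t
  proof (rule tendsto_eventually)
    define b where "b = min 1 (t + (\<lfloor>real n * t\<rfloor> + 1 - real n * t) / (real n + 1))"
    have "real n * t < \<lfloor>real n * t\<rfloor> + 1" by linarith
    then have "t < b" using t by (auto simp: b_def)
    moreover have "step_fun n a v s = step_fun n a v t" if s: "t < s" "s < b" for s
    proof -
      have "(s - t) * (real n + 1) < \<lfloor>real n * t\<rfloor> + 1 - real n * t"
        using s by (auto simp: b_def field_simps)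
      moreover have "(s - t) * real n \<le> (s - t) * (real n + 1)"
        using s by (intro mult_left_mono) auto
      ultimately have "real n * s < \<lfloor>real n * t\<rfloor> + 1" by (simp add: algebra_simps)
      moreover have "real n * t \<le> real n * s" using s by (intro mult_left_mono) auto
      then have "\<lfloor>real n * t\<rfloor> \<le> real n * s" by linarith
      ultimately have "\<lfloor>real n * s\<rfloor> = \<lfloor>real n * t\<rfloor>" by (simp add: floor_eq_iff)
      moreover have "s \<in> {0..1}" "t \<in> {0..1}" using s t by (auto simp: b_def)
      ultimately show ?thesis by (simp add: step_fun_def)
    qed
    ultimately show "\<forall>\<^sub>F s in at_right t. step_fun n a v s = step_fun n a v t"
      unfolding eventually_at_right_field by blast
  qed
  have left: "\<exists>l. (step_fun n a v \<longlongrightarrow> l) (at_left t)" if t: "0 < t" "t \<le> 1" for t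
  proof (intro exI tendsto_eventually)
    define q where "q = \<lceil>real n * t\<rceil> - 1"
    define b where "b = max 0 (t - (real n * t - q) / (real n + 1))"
    have "q < real n * t" unfolding q_def by linarith
    then have "b < t" using t by (auto simp: b_def)
    moreover have "step_fun n a v s = (\<Sum>j<nat q. v j) / a" if s: "b < s" "s < t" for s
    proof -
      have s01: "s \<in> {0..1}" using s t by (auto simp: b_def)
      show ?thesis
      proof (cases "n = 0")
        case True
        then show ?thesis using s01 by (simp add: step_fun_def q_def)
      next
        case False
        have "(t - s) * (real n + 1) < real n * t - q"
          using s by (auto simp: b_def field_simps)
        moreover have "(t - s) * real n \<le> (t - s) * (real n + 1)"
          using s by (intro mult_left_mono) auto
        ultimately have "q \<le> real n * s" by (simp add: algebra_simps)
        moreover have "real n * s < real n * t" using s False by simp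
        then have "real n * s < q + 1" unfolding q_def by linarith
        ultimately have "\<lfloor>real n * s\<rfloor> = q" by (simp add: floor_eq_iff)
        then show ?thesis using s01 by (simp add: step_fun_def)
      qed
    qed
    ultimately show "\<forall>\<^sub>F s in at_left t. step_fun n a v s = (\<Sum>j<nat q. v j) / a"
      unfolding eventually_at_left_field by blast
  qed
  show ?thesis using left right by (auto simp: cadlag01_def step_fun_def)
qed

lemma polygonal_fun_continuous: "polygonal_fun n a v \<in> mspace C01"
proof -
  have "continuous_on {0..1} (\<lambda>t. (\<Sum>j<n. min 1 (max 0 (real n * t - real j)) * v j) / a)"
    unfolding divide_inverse by (intro continuous_intros)
  moreover have "continuous_on {0..1} (polygonal_fun n a v) \<longleftrightarrow>
      continuous_on {0..1} (\<lambda>t. (\<Sum>j<n. min 1 (max 0 (real n * t - real j)) * v j) / a)"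
    by (rule continuous_on_cong) (auto simp: polygonal_fun_def)
  ultimately show ?thesis by (simp add: mspace_C01) (simp add: polygonal_fun_def)
qed

lemma step_path_eq: "step_path T f a n \<omega> = step_fun n (a n) (\<lambda>j. f ((T ^^ j) \<omega>))"
  by (simp add: step_path_def step_fun_def step_sum_def partial_sum_def)

lemma polygonal_path_eq: "polygonal_path T f a n \<omega> = polygonal_fun n (a n) (\<lambda>j. f ((T ^^ j) \<omega>))"
proof -
  have "polygonal_sum T f n t \<omega> = (\<Sum>j<n. min 1 (max 0 (real n * t - real j)) * f ((T ^^ j) \<omega>))"
    (is "_ = (\<Sum>j<n. ?g j)") if t: "t \<in> {0..1}" for t
  proof -
    define k where "k = nat \<lfloor>real n * t\<rfloor>"
    have nt: "0 \<le> real n * t" "real n * t \<le> real n" using t by (auto intro: mult_left_le)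
    then have fl: "\<lfloor>real n * t\<rfloor> = int k" by (simp add: k_def)
    have k: "real k \<le> real n * t" "real n * t < real k + 1" using fl by linarith+
    have kn: "k \<le> n" using k nt by linarith
    have lo: "?g j = f ((T ^^ j) \<omega>)" if "j < k" for j
    proof -
      have "real j + 1 \<le> real k" using that by linarith
      then have "1 \<le> real n * t - real j" using k by linarith
      then show ?thesis by simp
    qed
    have hi: "?g j = 0" if "j > k" for j
    proof -
      have "real n * t \<le> real j" using that k by linarith
      then show ?thesis by simp
    qed
    have mid: "?g k = (real n * t - real k) * f ((T ^^ k) \<omega>)" using k by simp
    have "(\<Sum>j<n. ?g j) = (\<Sum>j<Suc k. ?g j)"
    proof (cases "k = n")
      case True
      then show ?thesis using nt k by (simp add: max_def)
    next
      case False
      then show ?thesis using kn hi by (intro sum.mono_neutral_right) auto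
    qed
    also have "\<dots> = (\<Sum>j<k. f ((T ^^ j) \<omega>)) + (real n * t - real k) * f ((T ^^ k) \<omega>)"
      using lo mid by (simp only: sum.lessThan_Suc) (auto intro!: sum.cong)
    also have "\<dots> = polygonal_sum T f n t \<omega>"
      by (simp add: polygonal_sum_def partial_sum_def fl)
    finally show ?thesis by simp
  qed
  then show ?thesis
    unfolding polygonal_path_def polygonal_fun_def by (intro restrict_ext) auto
qed

lemma step_path_measurable:
  assumes [measurable]: "T \<in> M \<rightarrow>\<^sub>M M" "f \<in> borel_measurable M"
  shows "step_path T f a n \<in> M \<rightarrow>\<^sub>M metric_borel D01"
proof -
  have "(\<lambda>\<omega>. step_fun n (a n) (\<lambda>j. f ((T ^^ j) \<omega>))) \<in> M \<rightarrow>\<^sub>M metric_borel D01"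
  proof (rule measurable_into_metric[where k = n and c = "inverse \<bar>a n\<bar>"])
    fix v w :: "nat \<Rightarrow> real"
    show "mdist D01 (step_fun n (a n) v) (step_fun n (a n) w) \<le> inverse \<bar>a n\<bar> * (\<Sum>i<n. \<bar>v i - w i\<bar>)"
      unfolding mdist_D01
    proof (rule skorohod_dist_le)
      fix t :: real assume t: "t \<in> {0..1}"
      have "real n * t \<le> real n" using t by (auto intro: mult_left_le)
      then have "nat \<lfloor>real n * t\<rfloor> \<le> n" by linarith
      then have "(\<Sum>j<nat \<lfloor>real n * t\<rfloor>. \<bar>v j - w j\<bar>) \<le> (\<Sum>i<n. \<bar>v i - w i\<bar>)"
        by (intro sum_mono2) auto
      then have "\<bar>\<Sum>j<nat \<lfloor>real n * t\<rfloor>. v j - w j\<bar> \<le> (\<Sum>i<n. \<bar>v i - w i\<bar>)"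
        using sum_abs[of "\<lambda>j. v j - w j" "{..<nat \<lfloor>real n * t\<rfloor>}"] by linarith
      then have "inverse \<bar>a n\<bar> * \<bar>\<Sum>j<nat \<lfloor>real n * t\<rfloor>. v j - w j\<bar> \<le> inverse \<bar>a n\<bar> * (\<Sum>i<n. \<bar>v i - w i\<bar>)"
        by (intro mult_left_mono) auto
      moreover have "step_fun n (a n) v t - step_fun n (a n) w t
          = (\<Sum>j<nat \<lfloor>real n * t\<rfloor>. v j - w j) / a n"
        using t by (simp add: step_fun_def sum_subtractf diff_divide_distrib)
      ultimately show "\<bar>step_fun n (a n) v t - step_fun n (a n) w t\<bar>
          \<le> inverse \<bar>a n\<bar> * (\<Sum>i<n. \<bar>v i - w i\<bar>)"
        by (simp add: divide_inverse abs_mult mult.commute)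
    qed (auto intro: sum_nonneg)
  qed (simp_all add: step_fun_cadlag)
  then show ?thesis by (simp add: step_path_eq[abs_def])
qed

lemma polygonal_path_measurable:
  assumes [measurable]: "T \<in> M \<rightarrow>\<^sub>M M" "f \<in> borel_measurable M"
  shows "polygonal_path T f a n \<in> M \<rightarrow>\<^sub>M metric_borel C01"
proof -
  have "(\<lambda>\<omega>. polygonal_fun n (a n) (\<lambda>j. f ((T ^^ j) \<omega>))) \<in> M \<rightarrow>\<^sub>M metric_borel C01"
  proof (rule measurable_into_metric[where k = n and c = "inverse \<bar>a n\<bar>"])
    fix v w :: "nat \<Rightarrow> real"
    show "mdist C01 (polygonal_fun n (a n) v) (polygonal_fun n (a n) w)
        \<le> inverse \<bar>a n\<bar> * (\<Sum>i<n. \<bar>v i - w i\<bar>)"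
    proof (rule mdist_C01_le)
      fix t :: real assume t: "t \<in> {0..1}"
      let ?c = "\<lambda>j. min 1 (max 0 (real n * t - real j))"
      have "\<bar>\<Sum>j<n. ?c j * (v j - w j)\<bar> \<le> (\<Sum>j<n. \<bar>?c j * (v j - w j)\<bar>)" by (rule sum_abs)
      also have "\<dots> \<le> (\<Sum>j<n. \<bar>v j - w j\<bar>)"
        by (intro sum_mono) (auto simp: abs_mult intro!: mult_left_le_one_le)
      finally have "inverse \<bar>a n\<bar> * \<bar>\<Sum>j<n. ?c j * (v j - w j)\<bar>
          \<le> inverse \<bar>a n\<bar> * (\<Sum>j<n. \<bar>v j - w j\<bar>)"
        by (intro mult_left_mono) auto
      moreover have "polygonal_fun n (a n) v t - polygonal_fun n (a n) w t
          = (\<Sum>j<n. ?c j * (v j - w j)) / a n"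
        using t by (simp add: polygonal_fun_def sum_subtractf diff_divide_distrib right_diff_distrib)
      ultimately show "\<bar>polygonal_fun n (a n) v t - polygonal_fun n (a n) w t\<bar>
          \<le> inverse \<bar>a n\<bar> * (\<Sum>i<n. \<bar>v i - w i\<bar>)"
        by (simp add: divide_inverse abs_mult mult.commute)
    qed (auto intro: sum_nonneg)
  qed (simp_all add: polygonal_fun_continuous)
  then show ?thesis by (simp add: polygonal_path_eq[abs_def])
qed

end

theory Submission
  imports Defs "HOL-Real_Asymp.Real_Asymp"
begin

text \<open>
  The space is the two-sided shift on i.i.d. uniform variables \<open>\<omega> j\<close> on \<open>[-1, 1]\<close>. The signs
  \<open>sgn (\<omega> j)\<close> are fair coins, and the heights \<open>H j = 1 / sqrt \<bar>\<omega> j\<bar>\<close> have the tail \<open>P(H j \<ge> h) = 1 / h\<^sup>2\<close>.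
  With the envelope \<open>g = sup\<^sub>j (H j - \<bar>j\<bar>)\<^sup>+\<close> of triangular peaks put \<open>f = sgn (\<omega> 0) + g - g \<circ> T\<close>.

  The envelope is 1-Lipschitz along orbits, so \<open>f\<close> is bounded. Since \<open>P(g > h) \<le> 4 / h\<close>, the coboundary
  contributes \<open>g - g \<circ> T\<^sup>n = o(\<surd>n)\<close> in probability to \<open>S\<^sub>n\<close> and \<open>O(n)\<close> to its variance, so the central
  limit theorem of the coin flips persists. However, with probability bounded away from 0 some height
  among the first \<open>n\<close> exceeds \<open>3 \<surd>n\<close>, while \<open>g \<le> \<surd>n\<close> holds on any fixed grid with probability close
  to 1; the paths then oscillate macroscopically within arbitrarily short time, which is incompatible
  with a continuous limit. Past and future at distance \<open>N\<close> depend on disjoint sets of coordinates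
  unless a peak is wider than \<open>N / 2\<close>, which gives the mixing rate \<open>O(1 / N)\<close>.
\<close>

section \<open>Absolute regularity by coupling\<close>

text \<open>The preimages of the blocks are again disjoint and cover the space. With a map in the
  statement, one lemma serves both a partition itself, through the identity, and its pullback under
  a coupling map.\<close>

lemma (in prob_space) sum_prob_vimage_partition:
  assumes "\<rho> \<in> M \<rightarrow>\<^sub>M M" "finite P" "partition_on (space M) P" "P \<subseteq> sets M" "E \<in> sets M"
  shows "(\<Sum>A\<in>P. prob ((\<rho> -` A \<inter> space M) \<inter> E)) = prob E"
proof -
  have "prob (\<Union>A\<in>P. (\<rho> -` A \<inter> space M) \<inter> E) = (\<Sum>A\<in>P. prob ((\<rho> -` A \<inter> space M) \<inter> E))"
  proof (rule finite_measure_finite_Union)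
    show "disjoint_family_on (\<lambda>A. (\<rho> -` A \<inter> space M) \<inter> E) P"
      using assms(3) unfolding disjoint_family_on_def partition_on_def pairwise_def disjnt_def by blast
  qed (use assms in \<open>auto intro!: sets.Int measurable_sets\<close>)
  moreover have "(\<Union>A\<in>P. (\<rho> -` A \<inter> space M) \<inter> E) = E"
    using assms(3) measurable_space[OF assms(1)] sets.sets_into_space[OF assms(5)]
    by (fastforce simp: partition_on_def)
  ultimately show ?thesis by simp
qed

text \<open>Replacing \<open>A\<close> and \<open>B\<close> by their preimages under
  \<open>\<rho>\<close> and \<open>\<sigma>\<close> makes them independent and changes them only
  inside \<open>N\<close>. There are three replacements, in \<open>A \<inter> B\<close>, in
  \<open>A\<close> and in \<open>B\<close>. Each costs at most \<open>2 * prob N\<close> after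
  summation, and the factor 1/2 in \<open>beta_coeff\<close> turns 6 into 3.\<close>

lemma beta_coeff_le_coupling:
  assumes "prob_space M" and sub: "\<A> \<subseteq> sets M" "\<B> \<subseteq> sets M" and N: "N \<in> sets M"
    and top: "space M \<in> \<A>" "space M \<in> \<B>"
    and \<rho>: "\<rho> \<in> M \<rightarrow>\<^sub>M M" and \<sigma>: "\<sigma> \<in> M \<rightarrow>\<^sub>M M"
    and \<A>: "\<And>A \<omega>. A \<in> \<A> \<Longrightarrow> \<omega> \<in> space M - N \<Longrightarrow> \<rho> \<omega> \<in> A \<longleftrightarrow> \<omega> \<in> A"
    and \<B>: "\<And>B \<omega>. B \<in> \<B> \<Longrightarrow> \<omega> \<in> space M - N \<Longrightarrow> \<sigma> \<omega> \<in> B \<longleftrightarrow> \<omega> \<in> B"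
    and indep: "\<And>A B. A \<in> \<A> \<Longrightarrow> B \<in> \<B> \<Longrightarrow>
      measure M ((\<rho> -` A \<inter> space M) \<inter> (\<sigma> -` B \<inter> space M))
        = measure M (\<rho> -` A \<inter> space M) * measure M (\<sigma> -` B \<inter> space M)"
  shows "beta_coeff M \<A> \<B> \<le> 3 * measure M N"
proof -
  interpret prob_space M by fact
  define p where "p A = \<rho> -` A \<inter> space M" for A
  define q where "q B = \<sigma> -` B \<inter> space M" for B
  have bound: "(\<Sum>A\<in>P. \<Sum>B\<in>Q. \<bar>prob (A \<inter> B) - prob A * prob B\<bar>) \<le> 6 * prob N"
    if P: "finite P" "partition_on (space M) P" "P \<subseteq> \<A>"
      and Q: "finite Q" "partition_on (space M) Q" "Q \<subseteq> \<B>" for P Q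
  proof -
    have PQ: "P \<subseteq> sets M" "Q \<subseteq> sets M" using P Q sub by auto
    have mp [measurable]: "p A \<in> sets M" if "A \<in> P" for A
      using that PQ \<rho> by (auto simp: p_def intro: measurable_sets)
    have mq [measurable]: "q B \<in> sets M" if "B \<in> Q" for B
      using that PQ \<sigma> by (auto simp: q_def intro: measurable_sets)
    have mP [measurable]: "A \<in> sets M" if "A \<in> P" for A using that PQ by auto
    have mQ [measurable]: "A \<in> sets M" if "A \<in> Q" for A using that PQ by auto
    note [measurable] = N
    have idM: "(\<lambda>x. x) \<in> M \<rightarrow>\<^sub>M M" by simp
    have spc: "((\<lambda>x. x) -` A \<inter> space M) = A" if "A \<in> sets M" for A
      using sets.sets_into_space[OF that] by auto
    have sP: "(\<Sum>A\<in>P. prob (A \<inter> E)) = prob E" "(\<Sum>A\<in>P. prob (p A \<inter> E)) = prob E"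
      if "E \<in> sets M" for E
      using sum_prob_vimage_partition[OF \<rho> P(1,2) PQ(1) that]
        sum_prob_vimage_partition[OF idM P(1,2) PQ(1) that] spc PQ
      by (auto simp: p_def subset_iff cong: sum.cong)
    have sQ: "(\<Sum>A\<in>Q. prob (A \<inter> E)) = prob E" "(\<Sum>A\<in>Q. prob (q A \<inter> E)) = prob E"
      if "E \<in> sets M" for E
      using sum_prob_vimage_partition[OF \<sigma> Q(1,2) PQ(2) that]
        sum_prob_vimage_partition[OF idM Q(1,2) PQ(2) that] spc PQ
      by (auto simp: q_def subset_iff cong: sum.cong)
    have sQ1: "(\<Sum>B\<in>Q. prob B) = 1" and sP1: "(\<Sum>A\<in>P. prob (p A)) = 1"
      using sQ(1)[OF sets.top] sP(2)[OF sets.top] PQ(2)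
      by (auto simp: prob_space p_def subset_iff cong: sum.cong)
    \<comment> \<open>The error keeps the traces of \<open>C\<close> and \<open>D\<close> on
      \<open>N\<close> instead of the cruder \<open>prob N\<close>: traces of disjoint blocks add up
      to \<open>prob N\<close>, whatever the number of blocks.\<close>
    have diff: "\<bar>prob C - prob D\<bar> \<le> prob (C \<inter> N) + prob (D \<inter> N)"
      if [measurable]: "C \<in> sets M" "D \<in> sets M" and CD: "\<And>\<omega>. \<omega> \<in> space M - N \<Longrightarrow> \<omega> \<in> C \<longleftrightarrow> \<omega> \<in> D" for C D
    proof -
      have "prob C \<le> prob (D \<union> (C \<inter> N))"
        using CD sets.sets_into_space[OF that(1)] by (intro finite_measure_mono) auto
      also have "\<dots> \<le> prob D + prob (C \<inter> N)" by (intro measure_Un_le) auto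
      finally have 1: "prob C \<le> prob D + prob (C \<inter> N)" .
      have "prob D \<le> prob (C \<union> (D \<inter> N))"
        using CD sets.sets_into_space[OF that(2)] by (intro finite_measure_mono) auto
      also have "\<dots> \<le> prob C + prob (D \<inter> N)" by (intro measure_Un_le) auto
      finally show ?thesis using 1 measure_nonneg[of M "C \<inter> N"] measure_nonneg[of M "D \<inter> N"] by linarith
    qed
    have dA: "\<bar>prob A - prob (p A)\<bar> \<le> prob (A \<inter> N) + prob (p A \<inter> N)" if "A \<in> P" for A
      using that P(3) \<A> by (intro diff mp mP) (auto simp: p_def)
    have dB: "\<bar>prob B - prob (q B)\<bar> \<le> prob (B \<inter> N) + prob (q B \<inter> N)" if "B \<in> Q" for B
      using that Q(3) \<B> by (intro diff mq mQ) (auto simp: q_def)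
    have dAB: "\<bar>prob (A \<inter> B) - prob (p A \<inter> q B)\<bar> \<le> prob (B \<inter> (A \<inter> N)) + prob (q B \<inter> (p A \<inter> N))"
      if "A \<in> P" "B \<in> Q" for A B
    proof -
      have "\<bar>prob (A \<inter> B) - prob (p A \<inter> q B)\<bar> \<le> prob (A \<inter> B \<inter> N) + prob (p A \<inter> q B \<inter> N)"
        using that P(3) Q(3) \<A> \<B> by (intro diff sets.Int mp mq mP mQ) (auto simp: p_def q_def)
      then show ?thesis by (simp add: Int_ac)
    qed
    have "\<bar>prob (A \<inter> B) - prob A * prob B\<bar> \<le>
        (prob (B \<inter> (A \<inter> N)) + prob (q B \<inter> (p A \<inter> N)))
        + (prob (A \<inter> N) + prob (p A \<inter> N)) * prob B + prob (p A) * (prob (B \<inter> N) + prob (q B \<inter> N))"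
      if AB: "A \<in> P" "B \<in> Q" for A B
    proof -
      have "prob (p A \<inter> q B) = prob (p A) * prob (q B)"
        using indep[of A B] AB P(3) Q(3) by (auto simp: p_def q_def)
      \<comment> \<open>By independence \<open>prob (p A \<inter> q B)\<close> cancels against
        \<open>prob (p A) * prob (q B)\<close>, which leaves one difference per replacement.\<close>
      then have "prob (A \<inter> B) - prob A * prob B = (prob (A \<inter> B) - prob (p A \<inter> q B))
          - (prob A - prob (p A)) * prob B - prob (p A) * (prob B - prob (q B))"
        by (simp add: algebra_simps)
      also have "\<bar>\<dots>\<bar> \<le> \<bar>prob (A \<inter> B) - prob (p A \<inter> q B)\<bar> + \<bar>prob A - prob (p A)\<bar> * prob B
          + prob (p A) * \<bar>prob B - prob (q B)\<bar>"
        using abs_mult[of "prob A - prob (p A)" "prob B"] abs_mult[of "prob (p A)" "prob B - prob (q B)"]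
        by (simp add: abs_le_iff) linarith
      also have "\<dots> \<le> (prob (B \<inter> (A \<inter> N)) + prob (q B \<inter> (p A \<inter> N)))
        + (prob (A \<inter> N) + prob (p A \<inter> N)) * prob B + prob (p A) * (prob (B \<inter> N) + prob (q B \<inter> N))"
        using AB by (intro add_mono dAB mult_right_mono mult_left_mono dA dB) auto
      finally show ?thesis .
    qed
    then have "(\<Sum>A\<in>P. \<Sum>B\<in>Q. \<bar>prob (A \<inter> B) - prob A * prob B\<bar>) \<le>
      (\<Sum>A\<in>P. \<Sum>B\<in>Q. (prob (B \<inter> (A \<inter> N)) + prob (q B \<inter> (p A \<inter> N)))
        + (prob (A \<inter> N) + prob (p A \<inter> N)) * prob B + prob (p A) * (prob (B \<inter> N) + prob (q B \<inter> N)))"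
      by (intro sum_mono)
    \<comment> \<open>Summing over \<open>B\<close> first collapses every trace of \<open>B\<close>
      or \<open>q B\<close> by total probability; the sum over \<open>A\<close> then leaves three
      terms of size \<open>2 * prob N\<close>.\<close>
    also have "\<dots> = (\<Sum>A\<in>P. (prob (A \<inter> N) + prob (p A \<inter> N)) + (prob (A \<inter> N) + prob (p A \<inter> N))
        + prob (p A) * (prob N + prob N))"
      by (rule sum.cong) (simp_all add: sum.distrib sQ sQ1 flip: sum_distrib_left)
    also have "\<dots> = 6 * prob N"
      by (simp add: sum.distrib sP sP1 flip: sum_distrib_right sum_distrib_left)
    finally show ?thesis .
  qed
  have "(SUP (P, Q) \<in> {P. finite P \<and> partition_on (space M) P \<and> P \<subseteq> \<A>} \<times>
                           {Q. finite Q \<and> partition_on (space M) Q \<and> Q \<subseteq> \<B>}.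
                \<Sum>A\<in>P. \<Sum>B\<in>Q. \<bar>prob (A \<inter> B) - prob A * prob B\<bar>) \<le> 6 * prob N"
  proof (rule cSUP_least)
    \<comment> \<open>The trivial partition shows that the supremum runs over a nonempty set, as its
      upper estimate requires.\<close>
    have "partition_on (space M) {space M}"
      using not_empty by (auto simp: partition_on_def)
    then show "{P. finite P \<and> partition_on (space M) P \<and> P \<subseteq> \<A>} \<times>
        {Q. finite Q \<and> partition_on (space M) Q \<and> Q \<subseteq> \<B>} \<noteq> {}"
      using top by (auto intro!: exI[of _ "{space M}"])
  qed (use bound in auto)
  then show ?thesis by (simp add: beta_coeff_def)
qed

lemma space_in_generated_sigma: "space M \<in> generated_sigma M X K"
  unfolding generated_sigma_def by (rule sigma_sets_top)

lemma generated_sigma_subset: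
  assumes "\<And>k. X k \<in> borel_measurable M"
  shows "generated_sigma M X K \<subseteq> sets M"
  unfolding generated_sigma_def using assms
  by (intro sets.sigma_sets_subset) (auto intro: measurable_sets)

text \<open>Sets that cannot separate \<open>\<omega>\<close> from \<open>\<omega>'\<close> are
  closed under the sigma-algebra operations and include the generators. This turns equality of
  process values after masking into the membership hypotheses of the coupling bound.\<close>

lemma generated_sigma_mem_cong:
  assumes "A \<in> generated_sigma M X K" "\<omega> \<in> space M" "\<omega>' \<in> space M"
    and "\<And>k. k \<in> K \<Longrightarrow> X k \<omega> = X k \<omega>'"
  shows "\<omega> \<in> A \<longleftrightarrow> \<omega>' \<in> A"
  using assms(1) unfolding generated_sigma_def
  by (induction rule: sigma_sets.induct) (use assms in auto)


section \<open>Oscillating paths have no continuous limit\<close>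

text \<open>Here \<open>s' = s\<close> and \<open>t' = t\<close> suffice. The conclusion allows
  moved times so that it has the same shape as for the Skorohod metric and one argument covers both
  spaces.\<close>

lemma C01_near:
  assumes "x \<in> mspace C01" "y \<in> mspace C01" "mdist C01 x y < e"
    and "s \<in> {0..1}" "t \<in> {0..1}" "\<bar>s - t\<bar> \<le> e"
  shows "\<exists>s'\<in>{0..1}. \<exists>t'\<in>{0..1}. \<bar>s' - t'\<bar> \<le> 3 * e \<and> \<bar>x s - x t\<bar> \<le> \<bar>y s' - y t'\<bar> + 2 * e"
proof -
  have "\<bar>x u - y u\<bar> \<le> e" if "u \<in> {0..1}" for u
    using mdist_cfunspace_imp_mdist_le[of x "top_of_set {0..1}" euclidean_metric y e u] assms that
    by (auto simp: C01_def dist_real_def)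
  from this[OF assms(4)] this[OF assms(5)] show ?thesis
    using assms by (intro bexI[of _ s] bexI[of _ t]) auto
qed

text \<open>A time change moves \<open>s\<close> and \<open>t\<close> by less than \<open>e\<close>
  each, which widens the gap to at most \<open>3 * e\<close>; the two values also move by less than
  \<open>e\<close> each.\<close>

lemma D01_near:
  assumes "x \<in> mspace D01" "y \<in> mspace D01" "mdist D01 x y < e"
    and "s \<in> {0..1}" "t \<in> {0..1}" "\<bar>s - t\<bar> \<le> e"
  shows "\<exists>s'\<in>{0..1}. \<exists>t'\<in>{0..1}. \<bar>s' - t'\<bar> \<le> 3 * e \<and> \<bar>x s - x t\<bar> \<le> \<bar>y s' - y t'\<bar> + 2 * e"
proof -
  have "Inf (skorohod_near x y) < e" using assms by (simp add: skorohod_dist_near)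
  moreover have "skorohod_near x y \<noteq> {}" using assms by (intro skorohod_near_nonempty) auto
  ultimately obtain d where d: "d \<in> skorohod_near x y" "d < e" by (metis cInf_lessD)
  then obtain l where l: "l \<in> time_changes"
    and le: "\<And>t. t \<in> {0..1} \<Longrightarrow> \<bar>l t - t\<bar> \<le> d \<and> \<bar>x t - y (l t)\<bar> \<le> d"
    by (auto simp: skorohod_near_def)
  have "l s \<in> {0..1}" "l t \<in> {0..1}" using l assms(4,5) by (auto simp: time_changes_def)
  moreover have "\<bar>l s - l t\<bar> \<le> 3 * e \<and> \<bar>x s - x t\<bar> \<le> \<bar>y (l s) - y (l t)\<bar> + 2 * e"
    using le[OF assms(4)] le[OF assms(5)] d(2) assms(6) by (auto simp: abs_le_iff)
  ultimately show ?thesis by blast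
qed

text \<open>The test function is the truncated distance to the set of all paths that jump by 1 within time
  \<open>1/q\<close>; for a continuous path it tends to 1 as \<open>q\<close> grows.\<close>

lemma not_weak_conv_brownian_of_oscillation:
  fixes m :: "(real \<Rightarrow> real) metric" and X :: "nat \<Rightarrow> 'a \<Rightarrow> real \<Rightarrow> real"
  assumes near: "\<And>x y e s t. x \<in> mspace m \<Longrightarrow> y \<in> mspace m \<Longrightarrow> mdist m x y < e \<Longrightarrow>
      s \<in> {0..1} \<Longrightarrow> t \<in> {0..1} \<Longrightarrow> \<bar>s - t\<bar> \<le> e \<Longrightarrow>
      \<exists>s'\<in>{0..1}. \<exists>t'\<in>{0..1}. \<bar>s' - t'\<bar> \<le> 3 * e \<and> \<bar>x s - x t\<bar> \<le> \<bar>y s' - y t'\<bar> + 2 * e"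
    and M: "prob_space M" and X: "\<And>n. X n \<in> M \<rightarrow>\<^sub>M metric_borel m"
    and W: "brownian_law m W" and \<eta>: "\<eta> > 0"
    and osc: "\<And>q::nat. q > 0 \<Longrightarrow> \<forall>\<^sub>F n in sequentially. \<exists>E\<in>sets M. measure M E \<ge> \<eta> \<and>
      (\<forall>\<omega>\<in>E. \<exists>s\<in>{0..1}. \<exists>t\<in>{0..1}. \<bar>s - t\<bar> \<le> 1 / real q \<and> \<bar>X n \<omega> s - X n \<omega> t\<bar> \<ge> 1)"
  shows "\<not> weak_conv_metric m (\<lambda>n. distr M (metric_borel m) (X n)) W"
proof
  assume conv: "weak_conv_metric m (\<lambda>n. distr M (metric_borel m) (X n)) W"
  interpret M: prob_space M by fact
  interpret m: Metric_space "mspace m" "mdist m" by simp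
  interpret W: prob_space W using W by (simp add: brownian_law_def standard_brownian_motion_def)
  have setsW: "sets W = sets (metric_borel m)" using W by (simp add: brownian_law_def)
  have sub: "{U. openin (mtopology_of m) U} \<subseteq> Pow (mspace m)" using openin_subset by fastforce
  have space: "space (metric_borel m) = mspace m"
    using sub by (simp add: metric_borel_def space_measure_of)
  have spaceW: "space W = mspace m" using sets_eq_imp_space_eq[OF setsW] space by simp
  define A where "A q = {x\<in>mspace m. \<exists>s\<in>{0..1}. \<exists>t\<in>{0..1}. \<bar>s - t\<bar> \<le> 1 / real q \<and> \<bar>x s - x t\<bar> \<ge> 1}"
    for q :: nat
  \<comment> \<open>With the factor \<open>real q\<close>, \<open>h q x < 1\<close> means that some
    path of \<open>A q\<close> lies within \<open>1 / q\<close> of \<open>x\<close>, the same scale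
    as the time window. The inserted 1 truncates and keeps the infimum over a nonempty set.\<close>
  define h where "h q x = Inf (insert 1 ((\<lambda>y. real q * mdist m x y) ` A q))" for q x
  have bdd: "bdd_below (insert 1 ((\<lambda>y. real q * mdist m x y) ` A q))" for q x
    by (rule bdd_belowI[of _ 0]) auto
  have h_le1: "h q x \<le> 1" for q x unfolding h_def using bdd by (intro cInf_lower) auto
  have h_ge0: "0 \<le> h q x" for q x unfolding h_def by (intro cInf_greatest) auto
  have h_le: "h q x \<le> real q * mdist m x y" if "y \<in> A q" for q x y
    unfolding h_def using bdd that by (intro cInf_lower) auto
  have h_lip: "h q x \<le> h q y + real q * mdist m x y" if "x \<in> mspace m" "y \<in> mspace m" for q x y
  proof -
    have "h q x - real q * mdist m x y \<le> h q y"
      unfolding h_def[of q y]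
    proof (rule cInf_greatest)
      fix d assume "d \<in> insert 1 ((\<lambda>z. real q * mdist m y z) ` A q)"
      then show "h q x - real q * mdist m x y \<le> d"
      proof
        assume "d = 1"
        moreover have "0 \<le> real q * mdist m x y" by simp
        ultimately show ?thesis using h_le1[of q x] by linarith
      next
        assume "d \<in> (\<lambda>z. real q * mdist m y z) ` A q"
        then obtain z where z: "z \<in> A q" "d = real q * mdist m y z" by auto
        then have "real q * mdist m x z \<le> real q * (mdist m x y + mdist m y z)"
          using that by (intro mult_left_mono m.triangle) (auto simp: A_def)
        then show ?thesis using h_le[OF z(1), of x] z(2) by (simp add: algebra_simps)
      qed
    qed simp
    then show ?thesis by simp
  qed
  \<comment> \<open>The function is Lipschitz with constant \<open>q\<close>; together with
    boundedness this makes it an admissible test function for weak convergence.\<close>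
  have cont: "continuous_map (mtopology_of m) euclideanreal (h q)" for q
  proof -
    have "Lipschitz_continuous_map m euclidean_metric (h q)"
      unfolding Lipschitz_continuous_map_def
    proof (intro conjI exI[of _ "real q"] ballI)
      fix x y assume xy: "x \<in> mspace m" "y \<in> mspace m"
      show "mdist euclidean_metric (h q x) (h q y) \<le> real q * mdist m x y"
        using h_lip[OF xy, of q] h_lip[OF xy(2,1), of q] m.commute[of x y] by (auto simp: dist_real_def abs_le_iff)
    qed auto
    from Lipschitz_continuous_imp_continuous_map[OF this] show ?thesis by (simp add: mtopology_of_euclidean)
  qed
  have bounded: "bounded (h q ` mspace m)" for q
    using h_le1 h_ge0 by (auto simp: bounded_iff intro!: exI[of _ 1])
  have meas: "h q \<in> borel_measurable (metric_borel m)" for q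
  proof (rule borel_measurableI)
    fix S :: "real set" assume "open S"
    then have "openin (mtopology_of m) {x \<in> topspace (mtopology_of m). h q x \<in> S}"
      using cont[of q] by (auto simp: continuous_map_def)
    moreover have "h q -` S \<inter> space (metric_borel m) = {x \<in> topspace (mtopology_of m). h q x \<in> S}"
      by (auto simp: space)
    ultimately show "h q -` S \<inter> space (metric_borel m) \<in> sets (metric_borel m)"
      using sub by (simp add: metric_borel_def)
  qed
  then have measW: "h q \<in> borel_measurable W" for q using setsW measurable_cong_sets by blast
  \<comment> \<open>On the oscillation event the path belongs to \<open>A q\<close>, where
    \<open>h q\<close> vanishes, and elsewhere \<open>h q\<close> is at most 1. The bound holds for
    all large \<open>n\<close> and survives the limit.\<close>
  have upper: "(\<integral>x. h q x \<partial>W) \<le> 1 - \<eta>" if "q > 0" for q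
  proof (rule LIMSEQ_le_const2)
    show "(\<lambda>n. \<integral>x. h q x \<partial>distr M (metric_borel m) (X n)) \<longlonglongrightarrow> (\<integral>x. h q x \<partial>W)"
      using conv cont bounded unfolding weak_conv_metric_def by blast
    from osc[OF that] obtain n0 where n0: "\<And>n. n \<ge> n0 \<Longrightarrow> \<exists>E\<in>sets M. measure M E \<ge> \<eta> \<and>
      (\<forall>\<omega>\<in>E. \<exists>s\<in>{0..1}. \<exists>t\<in>{0..1}. \<bar>s - t\<bar> \<le> 1 / real q \<and> \<bar>X n \<omega> s - X n \<omega> t\<bar> \<ge> 1)"
      unfolding eventually_sequentially by blast
    have "(\<integral>x. h q x \<partial>distr M (metric_borel m) (X n)) \<le> 1 - \<eta>" if n: "n \<ge> n0" for n
    proof -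
      from n0[OF n] obtain E where E: "E \<in> sets M" "measure M E \<ge> \<eta>"
        and EA: "\<And>\<omega>. \<omega> \<in> E \<Longrightarrow> \<exists>s\<in>{0..1}. \<exists>t\<in>{0..1}. \<bar>s - t\<bar> \<le> 1 / real q \<and> \<bar>X n \<omega> s - X n \<omega> t\<bar> \<ge> 1"
        by blast
      have hX: "(\<lambda>\<omega>. h q (X n \<omega>)) \<in> borel_measurable M"
        using X meas by (rule measurable_compose)
      have "(\<integral>x. h q x \<partial>distr M (metric_borel m) (X n)) = (\<integral>\<omega>. h q (X n \<omega>) \<partial>M)"
        using X meas by (rule integral_distr)
      also have "\<dots> \<le> (\<integral>\<omega>. 1 - indicator E \<omega> \<partial>M)"
      proof (rule integral_mono)
        show "integrable M (\<lambda>\<omega>. h q (X n \<omega>))"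
          using hX h_le1 h_ge0 by (intro M.integrable_const_bound[of _ 1]) auto
        show "integrable M (\<lambda>\<omega>. 1 - indicator E \<omega> :: real)"
          using E by (intro Bochner_Integration.integrable_diff) (auto simp: M.emeasure_eq_measure)
        fix \<omega> assume \<omega>: "\<omega> \<in> space M"
        have Xm: "X n \<omega> \<in> mspace m" using measurable_space[OF X \<omega>] space by simp
        show "h q (X n \<omega>) \<le> 1 - indicator E \<omega>"
        proof (cases "\<omega> \<in> E")
          case True
          then have "X n \<omega> \<in> A q" using EA Xm by (auto simp: A_def)
          from h_le[OF this, of "X n \<omega>"] show ?thesis using True Xm by simp
        qed (simp add: h_le1)
      qed
      also have "\<dots> = 1 - measure M E" using E by (simp add: M.prob_space M.emeasure_eq_measure)
      finally show ?thesis using E(2) by simp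
    qed
    then show "\<exists>N. \<forall>n\<ge>N. (\<integral>x. h q x \<partial>distr M (metric_borel m) (X n)) \<le> 1 - \<eta>" by blast
  qed
  \<comment> \<open>The opposite estimate: almost every path under \<open>W\<close> is uniformly
    continuous, so \<open>h q x\<close> is eventually 1, and dominated convergence applies.\<close>
  have "(\<lambda>q. \<integral>x. h q x \<partial>W) \<longlonglongrightarrow> (\<integral>x. 1 \<partial>W)"
  proof (rule integral_dominated_convergence[where w = "\<lambda>_. 1"])
    have "AE x in W. continuous_on {0..1} x"
      using W by (simp add: brownian_law_def standard_brownian_motion_def)
    with AE_space show "AE x in W. (\<lambda>q. h q x) \<longlonglongrightarrow> 1"
    proof eventually_elim
      case (elim x)
      then have x: "continuous_on {0..1} x" and xm: "x \<in> mspace m" by (simp_all add: spaceW)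
      have "uniformly_continuous_on {0..1} x"
        using x by (rule compact_uniformly_continuous) simp
      then obtain d where d: "d > 0"
        "\<And>s t. s \<in> {0..1} \<Longrightarrow> t \<in> {0..1} \<Longrightarrow> \<bar>s - t\<bar> < d \<Longrightarrow> \<bar>x s - x t\<bar> < 1 / 2"
        unfolding uniformly_continuous_on_def dist_real_def
        by (metis half_gt_zero zero_less_one)
      \<comment> \<open>Above \<open>3 / d\<close> the moved times are closer than \<open>d\<close>,
        so \<open>x\<close> varies by less than 1/2 between them; above 4 the loss
        \<open>2 / q\<close> is below 1/2. A jump of size 1 in a nearby path is then
        impossible.\<close>
      obtain q0 :: nat where q0: "real q0 > max (3 / d) 4" using reals_Archimedean2 by blast
      have "h q x = 1" if "q \<ge> q0" for q
      proof (rule ccontr)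
        assume "h q x \<noteq> 1"
        then have "h q x < 1" using h_le1[of q x] by simp
        then obtain v where v: "v \<in> insert 1 ((\<lambda>y. real q * mdist m x y) ` A q)" "v < 1"
          unfolding h_def by (subst (asm) cInf_less_iff) (use bdd in auto)
        then obtain y where y: "y \<in> A q" "real q * mdist m x y < 1" by auto
        have q: "real q > 3 / d" "real q > 4" using q0 that by auto
        obtain s t where st: "s \<in> {0..1}" "t \<in> {0..1}" "\<bar>s - t\<bar> \<le> 1 / real q" "\<bar>y s - y t\<bar> \<ge> 1"
          and ym: "y \<in> mspace m"
          using y(1) by (auto simp: A_def)
        have "mdist m y x < 1 / real q"
          using y(2) q m.commute[of x y] by (simp add: field_simps)
        from near[OF ym xm this st(1-3)] obtain s' t' where
          *: "s' \<in> {0..1}" "t' \<in> {0..1}" "\<bar>s' - t'\<bar> \<le> 3 * (1 / real q)"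
          "\<bar>y s - y t\<bar> \<le> \<bar>x s' - x t'\<bar> + 2 * (1 / real q)" by blast
        have "3 * (1 / real q) < d" "2 * (1 / real q) < 1 / 2"
          using q d(1) by (simp_all add: field_simps)
        then show False using d(2)[OF *(1,2)] *(3,4) st(4) by linarith
      qed
      then show "(\<lambda>q. h q x) \<longlonglongrightarrow> 1"
        by (intro tendsto_eventually) (auto simp: eventually_sequentially)
    qed
  qed (use measW h_le1 h_ge0 in auto)
  then have "(\<lambda>q. \<integral>x. h q x \<partial>W) \<longlonglongrightarrow> 1" by (simp add: W.prob_space)
  then have "1 \<le> 1 - \<eta>"
    by (rule LIMSEQ_le_const2) (use upper in \<open>auto intro!: exI[of _ 1]\<close>)
  then show False using \<eta> by simp
qed


section \<open>The peak envelope\<close>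

definition symmetric_uniform :: "real measure" where
  "symmetric_uniform = uniform_measure lborel {-1..1}"

definition noise :: "(int \<Rightarrow> real) measure" where
  "noise = (\<Pi>\<^sub>M i\<in>UNIV. symmetric_uniform)"

definition shift :: "int \<Rightarrow> (int \<Rightarrow> real) \<Rightarrow> int \<Rightarrow> real" where
  "shift k \<omega> = (\<lambda>j. \<omega> (j + k))"

text \<open>Division by zero gives \<open>height 0 = 0\<close>, so the origin is excluded in
  \<open>height_ge_iff\<close>; it is a null event for each coordinate.\<close>

definition height :: "real \<Rightarrow> real" where
  "height x = 1 / sqrt \<bar>x\<bar>"

text \<open>The value at the origin of a triangular peak of slope one centred at
  \<open>j\<close>.\<close>

definition peak :: "(int \<Rightarrow> real) \<Rightarrow> int \<Rightarrow> real" where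
  "peak \<omega> j = height (\<omega> j) - \<bar>real_of_int j\<bar>"

definition tame :: "(int \<Rightarrow> real) \<Rightarrow> bool" where
  "tame \<omega> \<longleftrightarrow> bdd_above (range (peak \<omega>))"

text \<open>The case distinction keeps the supremum away from unbounded sets, where it is unspecified.\<close>

definition envelope :: "(int \<Rightarrow> real) \<Rightarrow> real" where
  "envelope \<omega> = (SUP j. if tame \<omega> then max 0 (peak \<omega> j) else 0)"

definition observable :: "(int \<Rightarrow> real) \<Rightarrow> real" where
  "observable \<omega> = sgn (\<omega> 0) + envelope \<omega> - envelope (shift 1 \<omega>)"

section \<open>Shifts and the Lipschitz property of the envelope\<close>

lemma shift_0 [simp]: "shift 0 \<omega> = \<omega>"
  by (simp add: shift_def)

lemma shift_shift [simp]: "shift k (shift l \<omega>) = shift (k + l) \<omega>"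
  by (auto simp: shift_def ac_simps)

lemma shift_apply: "shift k \<omega> j = \<omega> (j + k)"
  by (simp add: shift_def)

lemma shift_funpow: "shift 1 ^^ n = shift (int n)"
  by (induction n) (auto simp: fun_eq_iff shift_def ac_simps)

lemma peak_shift_le: "peak (shift k \<omega>) j \<le> peak \<omega> (j + k) + \<bar>real_of_int k\<bar>"
  by (simp add: peak_def shift_def)

lemma tame_shiftI:
  assumes "tame \<omega>"
  shows "tame (shift k \<omega>)"
proof -
  obtain K where K: "\<And>j. peak \<omega> j \<le> K" using assms by (auto simp: tame_def bdd_above_def)
  have "peak (shift k \<omega>) j \<le> K + \<bar>real_of_int k\<bar>" for j
    using peak_shift_le[of k \<omega> j] K[of "j + k"] by linarith
  then show ?thesis unfolding tame_def by (intro bdd_aboveI) auto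
qed

text \<open>The exceptional set is invariant, so the case distinction in \<open>envelope\<close>
  falls the same way along a whole orbit.\<close>

lemma tame_shift [simp]: "tame (shift k \<omega>) \<longleftrightarrow> tame \<omega>"
  using tame_shiftI[of \<omega> k] tame_shiftI[of "shift k \<omega>" "- k"] by auto

lemma envelope_bdd: "bdd_above (range (\<lambda>j. if tame \<omega> then max 0 (peak \<omega> j) else 0))"
proof (cases "tame \<omega>")
  case True
  then obtain K where K: "\<And>j. peak \<omega> j \<le> K" by (auto simp: tame_def bdd_above_def)
  then show ?thesis by (intro bdd_aboveI[of _ "max 0 K"]) (auto simp: max.coboundedI2)
qed auto

lemma envelope_nonneg: "0 \<le> envelope \<omega>"
  unfolding envelope_def by (rule cSUP_upper2[OF envelope_bdd, of 0]) auto

lemma peak_le_envelope: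
  assumes "tame \<omega>"
  shows "peak \<omega> j \<le> envelope \<omega>"
  unfolding envelope_def by (rule cSUP_upper2[OF envelope_bdd, of j]) (use assms in auto)

lemma height_le_envelope_shift:
  assumes "tame \<omega>"
  shows "height (\<omega> k) \<le> envelope (shift k \<omega>)"
  using peak_le_envelope[of "shift k \<omega>" 0] assms by (simp add: peak_def shift_apply)

lemma envelope_leI:
  assumes "0 \<le> h" "\<And>j. tame \<omega> \<Longrightarrow> peak \<omega> j \<le> h"
  shows "envelope \<omega> \<le> h"
  unfolding envelope_def using assms by (intro cSUP_least) auto

text \<open>Slope one means that moving the observer by \<open>k\<close> raises no peak by more than
  \<open>\<bar>k\<bar>\<close>. The estimate holds for every \<open>\<omega>\<close>: on untamed
  sequences the envelope is 0 along the whole orbit.\<close>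

lemma envelope_shift_le: "envelope (shift k \<omega>) \<le> envelope \<omega> + \<bar>real_of_int k\<bar>"
proof (rule envelope_leI)
  fix j assume "tame (shift k \<omega>)"
  then show "peak (shift k \<omega>) j \<le> envelope \<omega> + \<bar>real_of_int k\<bar>"
    using peak_le_envelope[of \<omega> "j + k"] peak_shift_le[of k \<omega> j] by simp
qed (simp add: envelope_nonneg)

lemma envelope_shift_diff: "\<bar>envelope \<omega> - envelope (shift k \<omega>)\<bar> \<le> \<bar>real_of_int k\<bar>"
  using envelope_shift_le[of k \<omega>] envelope_shift_le[of "- k" "shift k \<omega>"] by simp

text \<open>The sign contributes at most 1 and the coboundary at most 1, being a Lipschitz increment
  over one step. All moments of the process are finite for this reason.\<close>

lemma observable_bounded: "\<bar>observable \<omega>\<bar> \<le> 2"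
  using envelope_shift_diff[of \<omega> 1] abs_sgn_eq[of "\<omega> 0"]
  by (auto simp: observable_def abs_le_iff sgn_real_def)

text \<open>The coboundary telescopes, so the envelope enters only through the two end
  points.\<close>

lemma partial_sum_observable:
  "partial_sum (shift 1) observable n \<omega>
     = (\<Sum>j<n. sgn (\<omega> (int j))) + envelope \<omega> - envelope (shift (int n) \<omega>)"
proof (induction n)
  case (Suc n)
  have "shift 1 (shift (int n) \<omega>) = shift (int (Suc n)) \<omega>" by simp
  with Suc show ?case
    by (simp add: partial_sum_def shift_funpow observable_def) (simp add: shift_def)
qed (simp add: partial_sum_def)


section \<open>The noise\<close>

lemma prob_space_symmetric_uniform: "prob_space symmetric_uniform"
  unfolding symmetric_uniform_def by (rule prob_space_uniform_measure) auto

lemma sets_symmetric_uniform [simp, measurable_cong]: "sets symmetric_uniform = sets borel"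
  by (simp add: symmetric_uniform_def)

lemma space_symmetric_uniform [simp]: "space symmetric_uniform = UNIV"
  by (simp add: symmetric_uniform_def)

lemma prob_space_noise: "prob_space noise"
  unfolding noise_def by (intro prob_space_PiM prob_space_symmetric_uniform)

interpretation noise: prob_space noise by (rule prob_space_noise)

lemma space_noise [simp]: "space noise = UNIV"
  by (simp add: noise_def space_PiM)

lemma prob_noise_UNIV [simp]: "noise.prob UNIV = 1"
  using noise.prob_space by simp

lemma sets_noise_Collect [measurable (raw)]: "Measurable.pred noise P \<Longrightarrow> {\<omega>. P \<omega>} \<in> sets noise"
  by (simp add: pred_def)

lemma measurable_coordinate [measurable]: "(\<lambda>\<omega>. \<omega> i) \<in> borel_measurable noise"
proof -
  have "(\<lambda>\<omega>. \<omega> i) \<in> noise \<rightarrow>\<^sub>M symmetric_uniform"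
    unfolding noise_def by measurable
  then show ?thesis by (simp cong: measurable_cong_sets)
qed

lemma measurable_into_noise:
  assumes "\<And>i. (\<lambda>x. F x i) \<in> borel_measurable M"
  shows "F \<in> M \<rightarrow>\<^sub>M noise"
proof -
  have "(\<lambda>x. \<lambda>i\<in>UNIV. F x i) \<in> M \<rightarrow>\<^sub>M noise"
    unfolding noise_def using assms by (intro measurable_restrict) (simp cong: measurable_cong_sets)
  then show ?thesis by (simp add: restrict_UNIV)
qed

lemma measurable_shift [measurable]: "shift k \<in> noise \<rightarrow>\<^sub>M noise"
  by (rule measurable_into_noise) (simp add: shift_def)

lemma distr_shift: "distr noise noise (shift k) = noise"
  using distr_PiM_reindex[of UNIV "\<lambda>_. symmetric_uniform" "\<lambda>i::int. i + k" UNIV]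
  by (simp add: noise_def prob_space_symmetric_uniform shift_def[abs_def] restrict_UNIV)

lemma distr_coordinate: "distr noise borel (\<lambda>\<omega>. \<omega> i) = symmetric_uniform"
proof -
  have "distr noise symmetric_uniform (\<lambda>\<omega>. \<omega> i) = symmetric_uniform"
    unfolding noise_def by (rule distr_PiM_component) (auto intro: prob_space_symmetric_uniform)
  then show ?thesis by (simp cong: distr_cong)
qed

text \<open>Reindexing by an injection yields both the two-sided family and, through
  \<open>int\<close>, the sequence indexed by naturals used for the central limit theorem and for
  the first \<open>n\<close> heights.\<close>

lemma indep_coordinates_inj:
  fixes f :: "'i \<Rightarrow> int"
  assumes "inj f"
  shows "noise.indep_vars (\<lambda>_. borel) (\<lambda>i \<omega>. \<omega> (f i)) UNIV"
proof (subst noise.indep_vars_iff_distr_eq_PiM)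
  have "sets (\<Pi>\<^sub>M i\<in>(UNIV::'i set). borel :: real measure) = sets (\<Pi>\<^sub>M i\<in>(UNIV::'i set). symmetric_uniform)"
    by (rule sets_PiM_cong) auto
  then have "distr noise (\<Pi>\<^sub>M i\<in>UNIV. borel) (\<lambda>x. \<lambda>i\<in>UNIV. x (f i))
      = distr noise (\<Pi>\<^sub>M i\<in>UNIV. symmetric_uniform) (\<lambda>x. \<lambda>i\<in>UNIV. x (f i))"
    by (intro distr_cong) auto
  also have "\<dots> = (\<Pi>\<^sub>M i\<in>UNIV. symmetric_uniform)"
    using distr_PiM_reindex[of UNIV "\<lambda>_. symmetric_uniform" f UNIV] assms
    by (simp add: noise_def prob_space_symmetric_uniform)
  finally show "distr noise (\<Pi>\<^sub>M i\<in>UNIV. borel) (\<lambda>x. \<lambda>i\<in>UNIV. x (f i))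
      = (\<Pi>\<^sub>M i\<in>UNIV. distr noise borel (\<lambda>\<omega>. \<omega> (f i)))"
    by (simp add: distr_coordinate)
qed auto

lemma indep_coordinates: "noise.indep_vars (\<lambda>_. borel) (\<lambda>i \<omega>. \<omega> i) UNIV"
  using indep_coordinates_inj[of "\<lambda>i. i"] by simp

section \<open>Symmetry of the noise under sign flips\<close>

lemma distr_uminus_symmetric_uniform: "distr symmetric_uniform borel uminus = symmetric_uniform"
proof (rule measure_eqI)
  fix A assume "A \<in> sets (distr symmetric_uniform borel uminus)"
  then have [measurable]: "A \<in> sets borel" by simp
  have "emeasure lborel ({-1..1} \<inter> uminus -` A) = emeasure (distr lborel borel uminus) ({-1..1} \<inter> A)"
    by (subst emeasure_distr) (auto intro!: arg_cong[where f = "emeasure lborel"])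
  then have "emeasure lborel ({-1..1} \<inter> uminus -` A) = emeasure lborel ({-1..1} \<inter> A)"
    by (simp add: lborel_distr_uminus)
  moreover have "uminus -` A \<in> sets borel"
    using measurable_sets[of uminus borel borel A] by simp
  moreover have "emeasure (distr symmetric_uniform borel uminus) A = emeasure symmetric_uniform (uminus -` A)"
    by (subst emeasure_distr) (auto intro!: measurable_ident_sets)
  ultimately show "emeasure (distr symmetric_uniform borel uminus) A = emeasure symmetric_uniform A"
    by (simp add: symmetric_uniform_def)
qed simp

text \<open>A flip changes signs but no height. Its invariance replaces an explicit statement that
  the signs are independent of the heights.\<close>

definition flip :: "int set \<Rightarrow> (int \<Rightarrow> real) \<Rightarrow> int \<Rightarrow> real" where
  "flip K \<omega> = (\<lambda>i. if i \<in> K then - \<omega> i else \<omega> i)"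

lemma flip_apply: "flip K \<omega> i = (if i \<in> K then - \<omega> i else \<omega> i)"
  by (simp add: flip_def)

lemma measurable_flip [measurable]: "flip K \<in> noise \<rightarrow>\<^sub>M noise"
  by (rule measurable_into_noise) (simp add: flip_def)

lemma distr_flip: "distr noise noise (flip K) = noise"
proof -
  have meas: "(\<lambda>x. if i \<in> K then - x else x :: real) \<in> borel_measurable borel" for i :: int
    by simp
  have ind: "noise.indep_vars (\<lambda>_. borel) (\<lambda>i \<omega>. flip K \<omega> i) UNIV"
    using noise.indep_vars_compose2[OF indep_coordinates meas] by (simp add: flip_def)
  then have "distr noise (\<Pi>\<^sub>M i\<in>UNIV. borel) (\<lambda>x. \<lambda>i\<in>UNIV. flip K x i)
      = (\<Pi>\<^sub>M i\<in>UNIV. distr noise borel (\<lambda>\<omega>. flip K \<omega> i))"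
    by (subst (asm) noise.indep_vars_iff_distr_eq_PiM) (auto simp: flip_def)
  moreover have "distr noise borel (\<lambda>\<omega>. flip K \<omega> i) = symmetric_uniform" for i
  proof -
    have "distr noise borel (\<lambda>\<omega>. - \<omega> i) = distr (distr noise borel (\<lambda>\<omega>. \<omega> i)) borel uminus"
      by (subst distr_distr) (auto simp: comp_def)
    then show ?thesis by (cases "i \<in> K") (simp_all add: flip_def distr_coordinate distr_uminus_symmetric_uniform)
  qed
  moreover have "sets (\<Pi>\<^sub>M i\<in>(UNIV::int set). borel :: real measure) = sets noise"
    unfolding noise_def by (rule sets_PiM_cong) auto
  then have "distr noise (\<Pi>\<^sub>M i\<in>UNIV. borel) (flip K) = distr noise noise (flip K)"
    by (intro distr_cong) auto
  ultimately show ?thesis by (simp add: restrict_UNIV flip: noise_def)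
qed

text \<open>Invariance of the law identifies the integral with its own negative. This removes the
  means of the signs, their covariances and the cross terms with the envelope.\<close>

lemma integral_flip_odd:
  fixes F :: "(int \<Rightarrow> real) \<Rightarrow> real"
  assumes [measurable]: "F \<in> borel_measurable noise" and odd: "\<And>\<omega>. F (flip K \<omega>) = - F \<omega>"
  shows "(\<integral>\<omega>. F \<omega> \<partial>noise) = 0"
proof -
  have "(\<integral>\<omega>. F \<omega> \<partial>noise) = (\<integral>\<omega>. F \<omega> \<partial>distr noise noise (flip K))"
    by (simp add: distr_flip)
  also have "\<dots> = (\<integral>\<omega>. F (flip K \<omega>) \<partial>noise)" by (rule integral_distr) auto
  also have "\<dots> = - (\<integral>\<omega>. F \<omega> \<partial>noise)" by (simp add: odd)
  finally show ?thesis by simp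
qed

lemma prob_flip:
  assumes "{\<omega>. P \<omega>} \<in> sets noise"
  shows "noise.prob {\<omega>. P (flip K \<omega>)} = noise.prob {\<omega>. P \<omega>}"
proof -
  have "noise.prob {\<omega>. P \<omega>} = measure (distr noise noise (flip K)) {\<omega>. P \<omega>}"
    by (simp add: distr_flip)
  also have "\<dots> = noise.prob {\<omega>. P (flip K \<omega>)}"
    using assms by (subst measure_distr) (auto simp: vimage_def)
  finally show ?thesis ..
qed

lemma height_minus [simp]: "height (- x) = height x"
  by (simp add: height_def)

lemma peak_flip [simp]: "peak (flip K \<omega>) = peak \<omega>"
  by (auto simp: peak_def flip_def)

lemma envelope_flip [simp]: "envelope (flip K \<omega>) = envelope \<omega>"
  by (simp add: envelope_def tame_def)

lemma envelope_shift_flip [simp]: "envelope (shift k (flip K \<omega>)) = envelope (shift k \<omega>)"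
proof -
  have "shift k (flip K \<omega>) = flip {i. i + k \<in> K} (shift k \<omega>)"
    by (auto simp: shift_def flip_def)
  then show ?thesis by simp
qed

section \<open>Law of the heights and measurability of the envelope\<close>

lemma height_ge_iff:
  assumes "h > 0"
  shows "h \<le> height x \<longleftrightarrow> x \<noteq> 0 \<and> \<bar>x\<bar> \<le> 1 / h\<^sup>2"
proof (cases "x = 0")
  case False
  then have "h \<le> height x \<longleftrightarrow> sqrt \<bar>x\<bar> \<le> 1 / h"
    using assms by (auto simp: height_def field_simps)
  also have "\<dots> \<longleftrightarrow> \<bar>x\<bar> \<le> (1 / h)\<^sup>2"
    using assms by (simp add: real_sqrt_le_iff' )
  finally show ?thesis using False by (simp add: power_divide)
qed (use assms in \<open>simp add: height_def\<close>)

lemma measurable_height [measurable]: "height \<in> borel_measurable borel"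
  unfolding height_def[abs_def] by measurable

lemma prob_height_ge:
  assumes "h \<ge> 1"
  shows "noise.prob {\<omega>. h \<le> height (\<omega> i)} = 1 / h\<^sup>2"
proof -
  \<comment> \<open>This keeps the interval of admissible values inside \<open>[-1, 1]\<close>, so
    that its uniform mass is exactly half its length.\<close>
  have h2: "1 / h\<^sup>2 \<le> 1" using assms by simp
  have "noise.prob {\<omega>. h \<le> height (\<omega> i)} = measure (distr noise borel (\<lambda>\<omega>. \<omega> i)) {x. h \<le> height x}"
    by (subst measure_distr) (auto intro!: arg_cong[where f = noise.prob])
  also have "\<dots> = measure symmetric_uniform {x. h \<le> height x}" by (simp add: distr_coordinate)
  also have "{x. h \<le> height x} = {- (1 / h\<^sup>2)..1 / h\<^sup>2} - {0}"
    using assms by (auto simp: height_ge_iff abs_le_iff)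
  also have "measure symmetric_uniform \<dots> = measure lborel ({-1..1} \<inter> ({- (1 / h\<^sup>2)..1 / h\<^sup>2} - {0})) / 2"
    unfolding symmetric_uniform_def by (subst measure_uniform_measure) auto
  also have "{-1..1} \<inter> ({- (1 / h\<^sup>2)..1 / h\<^sup>2} - {0}) = {- (1 / h\<^sup>2)..1 / h\<^sup>2} - {0}"
    using h2 by auto
  also have "measure lborel ({- (1 / h\<^sup>2)..1 / h\<^sup>2} - {0}) = measure lborel {- (1 / h\<^sup>2)..1 / h\<^sup>2}"
    by (rule measure_Diff_null_set) auto
  also have "\<dots> = 2 / h\<^sup>2" by (subst measure_lborel_Icc) auto
  finally show ?thesis by simp
qed

lemma measurable_peak [measurable]: "(\<lambda>\<omega>. peak \<omega> j) \<in> borel_measurable noise"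
  unfolding peak_def by measurable

text \<open>Natural bounds turn boundedness into countably many conditions, which makes it
  measurable.\<close>

lemma tame_iff: "tame \<omega> \<longleftrightarrow> (\<exists>K::nat. \<forall>j. peak \<omega> j \<le> real K)"
proof
  assume "tame \<omega>"
  then obtain K where K: "\<And>j. peak \<omega> j \<le> K" by (auto simp: tame_def bdd_above_def)
  then show "\<exists>K::nat. \<forall>j. peak \<omega> j \<le> real K"
    by (intro exI[of _ "nat \<lceil>K\<rceil>"] allI) (meson order_trans real_nat_ceiling_ge)
next
  assume "\<exists>K::nat. \<forall>j. peak \<omega> j \<le> real K"
  then obtain K :: nat where "\<And>j. peak \<omega> j \<le> real K" by auto
  then show "tame \<omega>" unfolding tame_def by (intro bdd_aboveI) auto
qed

lemma measurable_tame [measurable]: "Measurable.pred noise tame"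
  unfolding tame_iff by measurable

lemma measurable_envelope [measurable]: "envelope \<in> borel_measurable noise"
  unfolding envelope_def[abs_def]
  by (intro borel_measurable_cSUP envelope_bdd) (auto intro!: measurable_If)

lemma measurable_observable [measurable]: "observable \<in> borel_measurable noise"
  unfolding observable_def[abs_def] by measurable

lemma prob_shift:
  assumes "{\<omega>. P \<omega>} \<in> sets noise"
  shows "noise.prob {\<omega>. P (shift k \<omega>)} = noise.prob {\<omega>. P \<omega>}"
proof -
  have "noise.prob {\<omega>. P \<omega>} = measure (distr noise noise (shift k)) {\<omega>. P \<omega>}"
    by (simp add: distr_shift)
  also have "\<dots> = noise.prob {\<omega>. P (shift k \<omega>)}"
    using assms by (subst measure_distr) (auto simp: vimage_def)
  finally show ?thesis ..
qed


section \<open>Tails and moments of the envelope\<close>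

text \<open>A union bound over the squares \<open>1 / (r + i)^2\<close>, whose sum is of order
  \<open>1 / r\<close>. Only the law of each single height enters, so the positions
  \<open>k i\<close> may be arbitrary.\<close>

lemma prob_tail_heights:
  fixes k :: "nat \<Rightarrow> int"
  assumes r: "r \<ge> 1"
  shows "noise.prob {\<omega>. \<exists>i. r + real i \<le> height (\<omega> (k i))} \<le> 2 / r"
proof -
  define A where "A i = {\<omega>. r + real i \<le> height (\<omega> (k i))}" for i
  \<comment> \<open>With \<open>x = r + i - 1/2\<close>, the product \<open>x * (x + 1)\<close> is
    \<open>(r + i)^2 - 1/4\<close>, slightly below the square. Hence \<open>1 / (r + i)^2\<close> is
    dominated by a telescoping difference, and the sum is at most
    \<open>1 / (r - 1/2)\<close>.\<close>
  define b where "b i = 1 / (r + real i - 1 / 2)" for i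
  have [measurable]: "A i \<in> sets noise" for i unfolding A_def by measurable
  have A_le: "noise.prob (A i) \<le> b i - b (Suc i)" for i
  proof -
    have "noise.prob (A i) = 1 / (r + real i)\<^sup>2"
      unfolding A_def by (rule prob_height_ge) (use r in simp)
    also have "\<dots> \<le> 1 / ((r + real i - 1 / 2) * (r + real i + 1 / 2))"
    proof (rule frac_le)
      show "0 < (r + real i - 1 / 2) * (r + real i + 1 / 2)"
        using r by (intro mult_pos_pos) auto
      show "(r + real i - 1 / 2) * (r + real i + 1 / 2) \<le> (r + real i)\<^sup>2"
        by (simp add: power2_eq_square algebra_simps)
    qed auto
    also have "\<dots> = b i - b (Suc i)"
    proof -
      define x where "x = r + real i - 1 / 2"
      have "x > 0" using r by (simp add: x_def)
      then have "1 / (x * (x + 1)) = 1 / x - 1 / (x + 1)" by (simp add: field_simps)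
      then show ?thesis by (simp add: x_def b_def algebra_simps)
    qed
    finally show ?thesis .
  qed
  have "b \<longlonglongrightarrow> 0" unfolding b_def by real_asymp
  from telescope_sums'[OF this] have sums: "(\<lambda>i. b i - b (Suc i)) sums b 0" by simp
  have summable: "summable (\<lambda>i. noise.prob (A i))"
    by (rule summable_comparison_test[OF _ sums_summable[OF sums]]) (use A_le in auto)
  have "{\<omega>. \<exists>i. r + real i \<le> height (\<omega> (k i))} = (\<Union>i. A i)" by (auto simp: A_def)
  also have "noise.prob \<dots> \<le> (\<Sum>i. noise.prob (A i))"
    using summable by (intro noise.finite_measure_subadditive_countably) auto
  also have "\<dots> \<le> (\<Sum>i. b i - b (Suc i))"
    using summable sums by (intro suminf_le A_le) (auto simp: sums_iff)
  also have "\<dots> = b 0" using sums by (simp add: sums_iff)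
  also have "\<dots> \<le> 2 / r" using r by (simp add: b_def field_simps)
  finally show ?thesis .
qed

lemma prob_peak_gt:
  assumes h: "h \<ge> 1"
  shows "noise.prob {\<omega>. \<exists>j. h < peak \<omega> j} \<le> 4 / h"
proof -
  \<comment> \<open>The sign \<open>s\<close> selects a half-line of positions. Position 0 lies on
    both, which is harmless in a union bound and gives \<open>2 / h\<close> twice.\<close>
  define E where "E s = {\<omega>. \<exists>i. h + real i \<le> height (\<omega> (s * int i))}" for s :: int
  have [measurable]: "E s \<in> sets noise" for s unfolding E_def by measurable
  have "{\<omega>. \<exists>j. h < peak \<omega> j} \<subseteq> E 1 \<union> E (- 1)"
  proof safe
    fix \<omega> j assume *: "h < peak \<omega> j" "\<omega> \<notin> E (- 1)"
    show "\<omega> \<in> E 1"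
    proof (cases "j \<ge> 0")
      case True
      then show ?thesis using *(1) by (auto simp: E_def peak_def intro!: exI[of _ "nat j"])
    next
      case False
      then have "\<omega> \<in> E (- 1)" using *(1) by (auto simp: E_def peak_def intro!: exI[of _ "nat (- j)"])
      then show ?thesis using * by simp
    qed
  qed
  then have "noise.prob {\<omega>. \<exists>j. h < peak \<omega> j} \<le> noise.prob (E 1 \<union> E (- 1))"
    by (rule noise.finite_measure_mono) simp
  also have "\<dots> \<le> noise.prob (E 1) + noise.prob (E (- 1))" by (rule measure_Un_le) auto
  also have "\<dots> \<le> 2 / h + 2 / h" unfolding E_def by (intro add_mono prob_tail_heights h)
  finally show ?thesis by simp
qed

text \<open>An untamed sequence has peaks above every level, so its probability lies below
  \<open>4 / n\<close> for every positive \<open>n\<close>.\<close>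

lemma AE_tame: "AE \<omega> in noise. tame \<omega>"
proof -
  have "noise.prob {\<omega>. \<not> tame \<omega>} \<le> 4 / real (Suc n)" for n
  proof -
    have "{\<omega>. \<not> tame \<omega>} \<subseteq> {\<omega>. \<exists>j. real (Suc n) < peak \<omega> j}"
      unfolding tame_iff by (auto simp: not_le simp del: of_nat_Suc)
    then have "noise.prob {\<omega>. \<not> tame \<omega>} \<le> noise.prob {\<omega>. \<exists>j. real (Suc n) < peak \<omega> j}"
      by (rule noise.finite_measure_mono) measurable
    also have "\<dots> \<le> 4 / real (Suc n)" by (rule prob_peak_gt) simp
    finally show ?thesis .
  qed
  moreover have "(\<lambda>n. 4 / real (Suc n)) \<longlonglongrightarrow> 0" by real_asymp
  ultimately have "noise.prob {\<omega>. \<not> tame \<omega>} \<le> 0" by (intro LIMSEQ_le_const) auto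
  then have "noise.prob {\<omega>. \<not> tame \<omega>} = 0" using measure_nonneg[of noise] by (simp add: order_antisym)
  then show ?thesis
    by (subst AE_iff_measurable[OF _ refl]) (auto simp: noise.emeasure_eq_measure)
qed

lemma prob_envelope_gt:
  assumes h: "h \<ge> 1"
  shows "noise.prob {\<omega>. h < envelope \<omega>} \<le> 4 / h"
proof -
  have "{\<omega>. h < envelope \<omega>} \<subseteq> {\<omega>. \<exists>j. h < peak \<omega> j}"
    using envelope_leI[of h] h by (force simp: not_less[symmetric])
  then have "noise.prob {\<omega>. h < envelope \<omega>} \<le> noise.prob {\<omega>. \<exists>j. h < peak \<omega> j}"
    by (rule noise.finite_measure_mono) measurable
  with prob_peak_gt[OF h] show ?thesis by simp
qed

lemma prob_envelope_shift_gt: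
  assumes h: "h \<ge> 1"
  shows "noise.prob {\<omega>. h < envelope (shift k \<omega>)} \<le> 4 / h"
  proof -
  have "{\<omega>. h < envelope \<omega>} \<in> sets noise" by measurable
  from prob_shift[OF this, of k] prob_envelope_gt[OF h] show ?thesis by simp
qed

text \<open>Both envelopes are nonnegative, so a difference above \<open>h\<close> forces one of
  them above \<open>h\<close>. The bound is uniform in \<open>k\<close>.\<close>

lemma prob_envelope_diff_gt:
  assumes h: "h \<ge> 1"
  shows "noise.prob {\<omega>. h < \<bar>envelope \<omega> - envelope (shift k \<omega>)\<bar>} \<le> 8 / h"
proof -
  have "{\<omega>. h < \<bar>envelope \<omega> - envelope (shift k \<omega>)\<bar>} \<subseteq>
      {\<omega>. h < envelope \<omega>} \<union> {\<omega>. h < envelope (shift k \<omega>)}"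
  proof safe
    fix \<omega> assume "h < \<bar>envelope \<omega> - envelope (shift k \<omega>)\<bar>" "\<not> h < envelope (shift k \<omega>)"
    then show "h < envelope \<omega>" using envelope_nonneg[of \<omega>] envelope_nonneg[of "shift k \<omega>"] by linarith
  qed
  then have "noise.prob {\<omega>. h < \<bar>envelope \<omega> - envelope (shift k \<omega>)\<bar>} \<le>
      noise.prob ({\<omega>. h < envelope \<omega>} \<union> {\<omega>. h < envelope (shift k \<omega>)})"
    by (rule noise.finite_measure_mono) measurable
  also have "\<dots> \<le> noise.prob {\<omega>. h < envelope \<omega>} + noise.prob {\<omega>. h < envelope (shift k \<omega>)}"
    by (rule measure_Un_le) measurable
  also have "\<dots> \<le> 8 / h" using prob_envelope_gt[OF h] prob_envelope_shift_gt[OF h, of k] by simp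
  finally show ?thesis .
qed

lemma integral_observable: "(\<integral>\<omega>. observable \<omega> \<partial>noise) = 0"
proof -
  \<comment> \<open>The tail bound \<open>4 / h\<close> does not yield integrability of the
    envelope, so invariance cannot be applied to it directly. Truncation at \<open>K\<close>
    restores integrability and preserves the Lipschitz bound, so that dominated convergence removes
    it again.\<close>
  define d where "d K \<omega> = min (real K) (envelope \<omega>) - min (real K) (envelope (shift 1 \<omega>))" for K \<omega>
  have [measurable]: "d K \<in> borel_measurable noise" for K unfolding d_def by measurable
  have d_le: "\<bar>d K \<omega>\<bar> \<le> 1" for K \<omega>
    using envelope_shift_diff[of \<omega> 1] by (auto simp: d_def min_def abs_le_iff)
  have int: "integrable noise (\<lambda>\<omega>. min (real K) (envelope (shift k \<omega>)))" for K k
    using envelope_nonneg by (intro noise.integrable_const_bound[of _ "real K"]) (auto simp: min_def)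
  have "(\<integral>\<omega>. min (real K) (envelope \<omega>) \<partial>distr noise noise (shift 1))
      = (\<integral>\<omega>. min (real K) (envelope (shift 1 \<omega>)) \<partial>noise)" for K
    by (rule integral_distr) auto
  then have "(\<integral>\<omega>. d K \<omega> \<partial>noise) = 0" for K
    unfolding d_def using int[of K 0] int[of K 1] by (simp add: distr_shift)
  moreover have "(\<lambda>K. \<integral>\<omega>. d K \<omega> \<partial>noise) \<longlonglongrightarrow> (\<integral>\<omega>. envelope \<omega> - envelope (shift 1 \<omega>) \<partial>noise)"
  proof (rule integral_dominated_convergence[where w = "\<lambda>_. 1"])
    have "(\<lambda>K. d K \<omega>) \<longlonglongrightarrow> envelope \<omega> - envelope (shift 1 \<omega>)" for \<omega>
    proof (rule tendsto_eventually)
      obtain K0 :: nat where "real K0 > max (envelope \<omega>) (envelope (shift 1 \<omega>))"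
        using reals_Archimedean2 by blast
      then have "d K \<omega> = envelope \<omega> - envelope (shift 1 \<omega>)" if "K \<ge> K0" for K
        using that of_nat_mono[OF that, where 'a = real] by (simp add: d_def min_def)
      then show "\<forall>\<^sub>F K in sequentially. d K \<omega> = envelope \<omega> - envelope (shift 1 \<omega>)"
        by (auto simp: eventually_sequentially)
    qed
    then show "AE \<omega> in noise. (\<lambda>K. d K \<omega>) \<longlonglongrightarrow> envelope \<omega> - envelope (shift 1 \<omega>)" by simp
  qed (use d_le in auto)
  ultimately have "(\<integral>\<omega>. envelope \<omega> - envelope (shift 1 \<omega>) \<partial>noise) = 0"
    by (simp add: LIMSEQ_const_iff)
  moreover have "(\<integral>\<omega>. sgn (\<omega> 0) \<partial>noise) = 0"
    by (rule integral_flip_odd[of _ UNIV]) (auto simp: flip_apply sgn_minus)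
  moreover have "integrable noise (\<lambda>\<omega>. sgn (\<omega> 0) :: real)"
    by (intro noise.integrable_const_bound[of _ 1]) (auto simp: abs_sgn_eq)
  moreover have "integrable noise (\<lambda>\<omega>. envelope \<omega> - envelope (shift 1 \<omega>))"
    using envelope_shift_diff[of _ 1] by (intro noise.integrable_const_bound[of _ 1]) auto
  moreover have "observable \<omega> = sgn (\<omega> 0) + (envelope \<omega> - envelope (shift 1 \<omega>))" for \<omega>
    by (simp add: observable_def)
  ultimately show ?thesis by (simp del: Bochner_Integration.integral_diff)
qed

section \<open>Variance of the partial sums\<close>

definition sign_sum :: "nat \<Rightarrow> (int \<Rightarrow> real) \<Rightarrow> real" where
  "sign_sum n \<omega> = (\<Sum>j<n. sgn (\<omega> (int j)))"

lemma measurable_sign_sum [measurable]: "sign_sum n \<in> borel_measurable noise"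
  unfolding sign_sum_def[abs_def] by measurable

lemma sign_sum_bound: "\<bar>sign_sum n \<omega>\<bar> \<le> real n"
proof -
  have "\<bar>sign_sum n \<omega>\<bar> \<le> (\<Sum>j<n. \<bar>sgn (\<omega> (int j))\<bar>)" unfolding sign_sum_def by (rule sum_abs)
  also have "\<dots> \<le> (\<Sum>j<n. 1)" by (rule sum_mono) (simp add: abs_sgn_eq)
  finally show ?thesis by simp
qed

lemma integrable_sign_sum_square: "integrable noise (\<lambda>\<omega>. (sign_sum n \<omega>)\<^sup>2)"
proof (rule noise.integrable_const_bound[of _ "(real n)\<^sup>2"])
  have "(sign_sum n \<omega>)\<^sup>2 \<le> (real n)\<^sup>2" for \<omega>
    using sign_sum_bound[of n \<omega>] abs_le_square_iff[of "sign_sum n \<omega>" "real n"] by simp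
  then show "AE \<omega> in noise. norm ((sign_sum n \<omega>)\<^sup>2) \<le> (real n)\<^sup>2" by simp
qed measurable

lemma AE_coordinate_nonzero: "AE \<omega> in noise. \<omega> i \<noteq> 0"
proof -
  have "AE x in symmetric_uniform. x \<noteq> 0"
    unfolding symmetric_uniform_def
  proof (rule AE_uniform_measureI)
    show "AE x in lborel. x \<in> {-1..1} \<longrightarrow> x \<noteq> (0::real)"
      using AE_lborel_singleton[of "0::real"] by eventually_elim simp
  qed simp
  then have "AE x in distr noise borel (\<lambda>\<omega>. \<omega> i). x \<noteq> 0" unfolding distr_coordinate .
  then show ?thesis by (subst (asm) AE_distr_iff) auto
qed

text \<open>Flipping the single coordinate \<open>int n\<close> makes the cross term of the
  induction step odd; the square of the new sign is almost surely 1.\<close>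

lemma integral_sign_sum_square: "(\<integral>\<omega>. (sign_sum n \<omega>)\<^sup>2 \<partial>noise) = real n"
proof (induction n)
  case (Suc n)
  note int1 = integrable_sign_sum_square[of n]
  have int2: "integrable noise (\<lambda>\<omega>. 2 * (sign_sum n \<omega> * sgn (\<omega> (int n))))"
  proof (intro integrable_mult_right noise.integrable_const_bound[of _ "real n"])
    have "\<bar>sign_sum n \<omega> * sgn (\<omega> (int n))\<bar> \<le> real n * 1" for \<omega>
      unfolding abs_mult by (intro mult_mono sign_sum_bound) (auto simp: abs_sgn_eq)
    then show "AE \<omega> in noise. norm (sign_sum n \<omega> * sgn (\<omega> (int n))) \<le> real n" by simp
  qed auto
  have "(\<integral>\<omega>. (sign_sum (Suc n) \<omega>)\<^sup>2 \<partial>noise)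
      = (\<integral>\<omega>. (sign_sum n \<omega>)\<^sup>2 + 2 * (sign_sum n \<omega> * sgn (\<omega> (int n))) + 1 \<partial>noise)"
  proof (rule integral_cong_AE)
    show "AE \<omega> in noise. (sign_sum (Suc n) \<omega>)\<^sup>2
        = (sign_sum n \<omega>)\<^sup>2 + 2 * (sign_sum n \<omega> * sgn (\<omega> (int n))) + 1"
      using AE_coordinate_nonzero[of "int n"]
      by eventually_elim (auto simp: sign_sum_def power2_sum sgn_real_def)
  qed auto
  also have "\<dots> = real n + 2 * (\<integral>\<omega>. sign_sum n \<omega> * sgn (\<omega> (int n)) \<partial>noise) + 1"
    using Suc int1 int2 by (simp add: noise.prob_space)
  also have "(\<integral>\<omega>. sign_sum n \<omega> * sgn (\<omega> (int n)) \<partial>noise) = 0"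
    by (rule integral_flip_odd[of _ "{int n}"]) (auto simp: flip_apply sgn_minus sign_sum_def)
  finally show ?case by simp
qed (simp add: sign_sum_def)

lemma integrable_envelope_diff_square:
  "integrable noise (\<lambda>\<omega>. (envelope \<omega> - envelope (shift k \<omega>))\<^sup>2)"
proof (rule noise.integrable_const_bound[of _ "(real_of_int k)\<^sup>2"])
  show "AE \<omega> in noise. norm ((envelope \<omega> - envelope (shift k \<omega>))\<^sup>2) \<le> (real_of_int k)\<^sup>2"
    using envelope_shift_diff[of _ k] by (simp flip: abs_le_square_iff)
qed auto

text \<open>Layer-cake summation of a tail of order \<open>1 / h\<close> with weights of order
  \<open>h\<close> gives a bounded amount per level. The Lipschitz bound stops the levels at
  \<open>n\<close>, hence linear growth.\<close>

lemma integral_envelope_diff_square_le: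
  "(\<integral>\<omega>. (envelope \<omega> - envelope (shift (int n) \<omega>))\<^sup>2 \<partial>noise) \<le> 24 * real n"
proof -
  define D where "D \<omega> = \<bar>envelope \<omega> - envelope (shift (int n) \<omega>)\<bar>" for \<omega>
  have [measurable]: "D \<in> borel_measurable noise" unfolding D_def by measurable
  have D: "0 \<le> D \<omega>" "D \<omega> \<le> real n" for \<omega>
    using envelope_shift_diff[of \<omega> "int n"] by (auto simp: D_def)
  have square: "(\<Sum>h<k. 2 * real h + 1) = (real k)\<^sup>2" for k
    by (induction k) (auto simp: power2_eq_square algebra_simps)
  \<comment> \<open>\<open>D\<close> is rounded up to an integer \<open>k\<close>, and
    \<open>k^2\<close> is the sum of the first \<open>k\<close> odd numbers; every
    \<open>h < k\<close> satisfies \<open>h < D\<close>.\<close>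
  have D2: "(D \<omega>)\<^sup>2 \<le> (\<Sum>h<n. (2 * real h + 1) * indicator {\<omega>. real h < D \<omega>} \<omega>)" for \<omega>
  proof -
    define k where "k = nat \<lceil>D \<omega>\<rceil>"
    have k: "k \<le> n" "D \<omega> \<le> real k" "\<And>h. h < k \<Longrightarrow> real h < D \<omega>"
      using D[of \<omega>] by (auto simp: k_def nat_le_iff ceiling_le_iff zless_nat_eq_int_zless less_ceiling_iff)
    have "(D \<omega>)\<^sup>2 \<le> (real k)\<^sup>2" using k D by (intro power_mono) auto
    also have "\<dots> = (\<Sum>h<k. (2 * real h + 1) * indicator {\<omega>. real h < D \<omega>} \<omega>)"
      using k(3) by (simp flip: square)
    also have "\<dots> \<le> (\<Sum>h<n. (2 * real h + 1) * indicator {\<omega>. real h < D \<omega>} \<omega>)"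
      using k(1) by (intro sum_mono2) (auto intro!: mult_nonneg_nonneg)
    finally show ?thesis .
  qed
  have integrable_D: "integrable noise (\<lambda>\<omega>. (D \<omega>)\<^sup>2)"
    using integrable_envelope_diff_square[of "int n"] by (simp add: D_def)
  have "(\<integral>\<omega>. (D \<omega>)\<^sup>2 \<partial>noise) \<le> (\<integral>\<omega>. (\<Sum>h<n. (2 * real h + 1) * indicator {\<omega>. real h < D \<omega>} \<omega>) \<partial>noise)"
    using integrable_D D2
    by (intro integral_mono Bochner_Integration.integrable_sum integrable_mult_right)
      (auto simp: noise.emeasure_eq_measure intro!: integrable_real_indicator)
  also have "\<dots> = (\<Sum>h<n. (2 * real h + 1) * noise.prob {\<omega>. real h < D \<omega>})"
    by (subst Bochner_Integration.integral_sum) (auto simp: noise.emeasure_eq_measure)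
  also have "\<dots> \<le> (\<Sum>h<n. 24)"
  proof (rule sum_mono)
    fix h
    show "(2 * real h + 1) * noise.prob {\<omega>. real h < D \<omega>} \<le> 24"
    \<comment> \<open>The tail estimate starts at level 1, so level 0 uses the trivial bound by 1.
      Elsewhere \<open>(2 * h + 1) * 8 / h\<close> is at most 24.\<close>
    proof (cases "h = 0")
      case True
      then show ?thesis by (auto intro: order_trans[OF noise.prob_le_1])
    next
      case False
      then have h: "real h \<ge> 1" by linarith
      have "(2 * real h + 1) * noise.prob {\<omega>. real h < D \<omega>} \<le> (2 * real h + 1) * (8 / real h)"
        unfolding D_def using h by (intro mult_left_mono prob_envelope_diff_gt) auto
      also have "\<dots> \<le> 24" using h by (simp add: field_simps)
      finally show ?thesis .
    qed
  qed
  finally show ?thesis by (simp add: D_def mult.commute)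
qed

text \<open>Flipping all signs negates the sign sum and fixes the envelope difference, so the cross
  term vanishes: the variance is \<open>n\<close> plus a second moment between 0 and
  \<open>24 * n\<close>.\<close>

lemma sum_variance_observable:
  "real n \<le> sum_variance noise (shift 1) observable n"
  "sum_variance noise (shift 1) observable n \<le> 25 * real n"
proof -
  define D where "D \<omega> = envelope \<omega> - envelope (shift (int n) \<omega>)" for \<omega>
  have [measurable]: "D \<in> borel_measurable noise" unfolding D_def by measurable
  note int1 = integrable_sign_sum_square[of n]
  have int2: "integrable noise (\<lambda>\<omega>. 2 * (sign_sum n \<omega> * D \<omega>))"
  proof (intro integrable_mult_right noise.integrable_const_bound[of _ "real n * real n"])
    have "\<bar>sign_sum n \<omega> * D \<omega>\<bar> \<le> real n * real n" for \<omega>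
      unfolding abs_mult D_def using envelope_shift_diff[of \<omega> "int n"]
      by (intro mult_mono sign_sum_bound) auto
    then show "AE \<omega> in noise. norm (sign_sum n \<omega> * D \<omega>) \<le> real n * real n" by simp
  qed auto
  have int3: "integrable noise (\<lambda>\<omega>. (D \<omega>)\<^sup>2)"
    unfolding D_def by (rule integrable_envelope_diff_square)
  have "sum_variance noise (shift 1) observable n
      = (\<integral>\<omega>. (sign_sum n \<omega>)\<^sup>2 + 2 * (sign_sum n \<omega> * D \<omega>) + (D \<omega>)\<^sup>2 \<partial>noise)"
    unfolding sum_variance_def
    by (intro Bochner_Integration.integral_cong)
      (simp_all add: partial_sum_observable sign_sum_def D_def power2_eq_square algebra_simps)
  also have "\<dots> = real n + 2 * (\<integral>\<omega>. sign_sum n \<omega> * D \<omega> \<partial>noise) + (\<integral>\<omega>. (D \<omega>)\<^sup>2 \<partial>noise)"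
    using int1 int2 int3 by (simp add: integral_sign_sum_square)
  also have "(\<integral>\<omega>. sign_sum n \<omega> * D \<omega> \<partial>noise) = 0"
    by (rule integral_flip_odd[of _ UNIV])
      (auto simp: D_def sign_sum_def flip_apply sgn_minus sum_negf)
  finally have eq: "sum_variance noise (shift 1) observable n = real n + (\<integral>\<omega>. (D \<omega>)\<^sup>2 \<partial>noise)"
    by simp
  then show "real n \<le> sum_variance noise (shift 1) observable n"
    by (simp add: integral_nonneg_AE)
  show "sum_variance noise (shift 1) observable n \<le> 25 * real n"
    using eq integral_envelope_diff_square_le[of n] by (simp add: D_def)
qed


section \<open>The central limit theorem\<close>

text \<open>Slutsky's theorem for sums, by characteristic functions. The factor
  \<open>iexp (t * Z n \<omega>)\<close> differs from 1 by at most \<open>\<bar>t\<bar> * e\<close>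
  where \<open>Z n\<close> is at most \<open>e\<close> in absolute value, and by at most 2 on the
  remaining event.\<close>

lemma (in prob_space) weak_conv_m_add_vanishing:
  fixes X Z :: "nat \<Rightarrow> 'a \<Rightarrow> real"
  assumes [measurable]: "\<And>n. X n \<in> borel_measurable M" "\<And>n. Z n \<in> borel_measurable M"
    and \<mu>: "real_distribution \<mu>" and conv: "weak_conv_m (\<lambda>n. distr M borel (X n)) \<mu>"
    and Z: "\<And>e. e > 0 \<Longrightarrow> (\<lambda>n. prob {\<omega> \<in> space M. e < \<bar>Z n \<omega>\<bar>}) \<longlonglongrightarrow> 0"
  shows "weak_conv_m (\<lambda>n. distr M borel (\<lambda>\<omega>. X n \<omega> + Z n \<omega>)) \<mu>"
proof (rule levy_continuity[OF _ \<mu>])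
  show "real_distribution (distr M borel (\<lambda>\<omega>. X n \<omega> + Z n \<omega>))" for n
    by (rule real_distribution_distr) measurable
  fix t :: real
  have lim: "(\<lambda>n. char (distr M borel (X n)) t) \<longlonglongrightarrow> char \<mu> t"
    using real_distribution_distr \<mu> conv by (intro levy_continuity1) auto
  have char: "char (distr M borel V) t = (CLINT \<omega>|M. iexp (t * V \<omega>))"
    if [measurable]: "V \<in> borel_measurable M" for V
    unfolding char_def by (rule integral_distr) measurable
  have int: "integrable M (\<lambda>\<omega>. iexp (t * V \<omega>))" if [measurable]: "V \<in> borel_measurable M" for V
    by (rule integrable_iexp) measurable
  have diff: "cmod (char (distr M borel (\<lambda>\<omega>. X n \<omega> + Z n \<omega>)) t - char (distr M borel (X n)) t)
      \<le> \<bar>t\<bar> * e + 2 * prob {\<omega> \<in> space M. e < \<bar>Z n \<omega>\<bar>}" if e: "e > 0" for n e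
  proof -
    have XZ: "(\<lambda>\<omega>. X n \<omega> + Z n \<omega>) \<in> borel_measurable M" by measurable
    have "char (distr M borel (\<lambda>\<omega>. X n \<omega> + Z n \<omega>)) t - char (distr M borel (X n)) t
        = (CLINT \<omega>|M. iexp (t * (X n \<omega> + Z n \<omega>)) - iexp (t * X n \<omega>))"
      unfolding char[OF XZ] char[OF assms(1)]
      by (rule Bochner_Integration.integral_diff[symmetric, OF int[OF XZ] int[OF assms(1)]])
    also have "cmod \<dots> \<le> (\<integral>\<omega>. cmod (iexp (t * (X n \<omega> + Z n \<omega>)) - iexp (t * X n \<omega>)) \<partial>M)"
      by (rule integral_norm_bound)
    also have "\<dots> \<le> (\<integral>\<omega>. \<bar>t\<bar> * e + 2 * indicator {\<omega> \<in> space M. e < \<bar>Z n \<omega>\<bar>} \<omega> \<partial>M)"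
    proof (rule integral_mono)
      show "integrable M (\<lambda>\<omega>. cmod (iexp (t * (X n \<omega> + Z n \<omega>)) - iexp (t * X n \<omega>)))"
        by (rule integrable_norm[OF Bochner_Integration.integrable_diff[OF int[OF XZ] int[OF assms(1)]]])
      show "integrable M (\<lambda>\<omega>. \<bar>t\<bar> * e + 2 * indicator {\<omega> \<in> space M. e < \<bar>Z n \<omega>\<bar>} \<omega>)"
        by (intro Bochner_Integration.integrable_add integrable_mult_right integrable_real_indicator)
          (auto simp: emeasure_eq_measure)
      fix \<omega> assume \<omega>: "\<omega> \<in> space M"
      have "iexp (t * (X n \<omega> + Z n \<omega>)) - iexp (t * X n \<omega>)
          = iexp (t * X n \<omega>) * (iexp (t * Z n \<omega>) - 1)"
        by (simp add: ring_distribs exp_add)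
      then have eq: "cmod (iexp (t * (X n \<omega> + Z n \<omega>)) - iexp (t * X n \<omega>)) = cmod (iexp (t * Z n \<omega>) - 1)"
        by (simp add: norm_mult)
      show "cmod (iexp (t * (X n \<omega> + Z n \<omega>)) - iexp (t * X n \<omega>))
          \<le> \<bar>t\<bar> * e + 2 * indicator {\<omega> \<in> space M. e < \<bar>Z n \<omega>\<bar>} \<omega>"
      proof (cases "e < \<bar>Z n \<omega>\<bar>")
        case True
        have "cmod (iexp (t * Z n \<omega>) - 1) \<le> 2" using iexp_approx2[of "t * Z n \<omega>" 0] by simp
        moreover have "0 \<le> \<bar>t\<bar> * e" using e by simp
        ultimately show ?thesis using True \<omega> unfolding eq by simp
      next
        case False
        have "cmod (iexp (t * Z n \<omega>) - 1) \<le> \<bar>t\<bar> * \<bar>Z n \<omega>\<bar>"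
          using iexp_approx1[of "t * Z n \<omega>" 0] by (simp add: abs_mult)
        also have "\<dots> \<le> \<bar>t\<bar> * e" using False by (intro mult_left_mono) auto
        finally show ?thesis using False unfolding eq by simp
      qed
    qed
    also have "\<dots> = \<bar>t\<bar> * e + 2 * prob {\<omega> \<in> space M. e < \<bar>Z n \<omega>\<bar>}"
      by (subst Bochner_Integration.integral_add) (auto simp: prob_space emeasure_eq_measure)
    finally show ?thesis .
  qed
  have "(\<lambda>n. char (distr M borel (\<lambda>\<omega>. X n \<omega> + Z n \<omega>)) t - char (distr M borel (X n)) t) \<longlonglongrightarrow> 0"
  proof (rule tendstoI)
    fix r :: real assume r: "r > 0"
    \<comment> \<open>This choice makes \<open>\<bar>t\<bar> * e \<le> r / 2\<close>, with the
      summand 1 covering \<open>t = 0\<close>. A probability below \<open>r / 4\<close> takes care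
      of the other half.\<close>
    define e where "e = r / (2 * (\<bar>t\<bar> + 1))"
    have e: "e > 0" using r by (simp add: e_def)
    have "\<bar>t\<bar> * e \<le> r / 2" using r by (simp add: e_def field_simps)
    moreover have "\<forall>\<^sub>F n in sequentially. prob {\<omega> \<in> space M. e < \<bar>Z n \<omega>\<bar>} < r / 4"
      using order_tendstoD(2)[OF Z[OF e], of "r / 4"] r by simp
    ultimately show "\<forall>\<^sub>F n in sequentially.
        dist (char (distr M borel (\<lambda>\<omega>. X n \<omega> + Z n \<omega>)) t - char (distr M borel (X n)) t) 0 < r"
      by (auto elim!: eventually_mono intro!: le_less_trans[OF diff[OF e]] simp: dist_norm)
  qed
  then show "(\<lambda>n. char (distr M borel (\<lambda>\<omega>. X n \<omega> + Z n \<omega>)) t) \<longlonglongrightarrow> char \<mu> t"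
    using tendsto_add[OF lim] by fastforce
qed

lemma clt_sign_sum:
  "weak_conv_m (\<lambda>n. distr noise borel (\<lambda>\<omega>. sign_sum n \<omega> / sqrt (real n))) std_normal_distribution"
proof -
  define X where "X i \<omega> = (sgn (\<omega> (int i)) :: real)" for i \<omega>
  have [measurable]: "X i \<in> borel_measurable noise" for i unfolding X_def by measurable
  have mean: "noise.expectation (X i) = 0" for i
    unfolding X_def by (rule integral_flip_odd[of _ UNIV]) (auto simp: flip_apply sgn_minus)
  have bound: "\<bar>X i \<omega>\<bar> \<le> 1" for i \<omega> by (simp add: X_def abs_sgn_eq)
  have square: "AE \<omega> in noise. (X i \<omega>)\<^sup>2 = 1" for i
    using AE_coordinate_nonzero[of "int i"] by eventually_elim (simp add: X_def sgn_real_def)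
  have "weak_conv_m (\<lambda>n. distr noise borel (\<lambda>\<omega>. (\<Sum>i<n. X i \<omega>) / sqrt (real n * 1\<^sup>2))) std_normal_distribution"
  proof (rule noise.central_limit_theorem_zero_mean[where \<mu> = "distr symmetric_uniform borel sgn"])
    show "noise.indep_vars (\<lambda>_. borel) X UNIV"
      using noise.indep_vars_compose2[OF indep_coordinates_inj[of int], of "\<lambda>_. sgn" "\<lambda>_. borel"]
      by (simp add: X_def[abs_def] inj_of_nat)
    show "noise.expectation (X n) = 0" for n by (rule mean)
    show "integrable noise (\<lambda>x. (X n x)\<^sup>2)" for n
      using square[of n] by (intro noise.integrable_const_bound[of _ 1]) auto
    have "(\<integral>\<omega>. (X n \<omega>)\<^sup>2 \<partial>noise) = (\<integral>\<omega>. 1 \<partial>noise)" for n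
      using square[of n] by (intro integral_cong_AE) auto
    then show "noise.variance (X n) = 1\<^sup>2" for n by (simp add: mean)
    show "distr noise borel (X n) = distr symmetric_uniform borel sgn" for n
      unfolding X_def distr_coordinate[symmetric, of "int n"]
      by (subst distr_distr) (auto simp: comp_def)
  qed simp
  then show ?thesis by (simp add: X_def sign_sum_def)
qed

lemma clt_observable: "clt_holds noise (shift 1) observable (\<lambda>n. sqrt (real n))"
proof -
  define Z where "Z n \<omega> = (envelope \<omega> - envelope (shift (int n) \<omega>)) / sqrt (real n)" for n \<omega>
  have "weak_conv_m (\<lambda>n. distr noise borel (\<lambda>\<omega>. sign_sum n \<omega> / sqrt (real n) + Z n \<omega>)) std_normal_distribution"
  proof (rule noise.weak_conv_m_add_vanishing[OF _ _ real_dist_normal_dist clt_sign_sum])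
    fix e :: real assume e: "e > 0"
    \<comment> \<open>The threshold on \<open>n\<close> is exactly what lifts the level
      \<open>e * sqrt n\<close> to at least 1, where the tail bound of the envelope difference
      holds.\<close>
    have "noise.prob {\<omega>. e < \<bar>Z n \<omega>\<bar>} \<le> 8 / (e * sqrt (real n))" if n: "real n \<ge> 1 / e\<^sup>2" for n
    proof -
      have "0 < 1 / e\<^sup>2" using e by simp
      then have "real n > 0" using n by linarith
      have "1 / e \<le> sqrt (real n)" using n e by (intro real_le_rsqrt) (simp add: power_divide)
      then have "1 \<le> e * sqrt (real n)" using e by (simp add: field_simps)
      from prob_envelope_diff_gt[OF this, of "int n"] \<open>real n > 0\<close>
      show ?thesis by (simp add: Z_def field_simps)
    qed
    moreover obtain n0 :: nat where "1 / e\<^sup>2 \<le> real n0" using real_arch_simple by blast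
    ultimately have "\<forall>\<^sub>F n in sequentially. noise.prob {\<omega>. e < \<bar>Z n \<omega>\<bar>} \<le> 8 / (e * sqrt (real n))"
      by (auto simp: eventually_sequentially intro!: exI[of _ n0])
    moreover have "(\<lambda>n. 8 / (e * sqrt (real n))) \<longlonglongrightarrow> 0" using e by real_asymp
    ultimately have "(\<lambda>n. noise.prob {\<omega>. e < \<bar>Z n \<omega>\<bar>}) \<longlonglongrightarrow> 0"
      by (rule tendsto_sandwich[rotated, OF _ tendsto_const]) auto
    then show "(\<lambda>n. noise.prob {\<omega> \<in> space noise. e < \<bar>Z n \<omega>\<bar>}) \<longlonglongrightarrow> 0" by simp
  qed (auto simp: Z_def)
  then show ?thesis
    by (simp add: clt_holds_def partial_sum_observable sign_sum_def Z_def add_divide_distrib diff_divide_distrib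
      add_diff_eq)
qed


section \<open>The mixing rate\<close>

lemma inv_shift: "the_inv_into UNIV (shift k) = shift (- k)"
proof
  fix \<omega>
  have "inj (shift k)" by (rule injI) (metis add.left_inverse shift_0 shift_shift)
  moreover have "shift k (shift (- k) \<omega>) = \<omega>" by simp
  ultimately show "the_inv_into UNIV (shift k) \<omega> = shift (- k) \<omega>"
    by (intro the_inv_into_f_eq) auto
qed

lemma int_iterate_shift: "int_iterate noise (shift 1) k = shift k"
proof -
  have "shift (- 1) ^^ n = shift (- int n)" for n
    by (induction n) (auto simp: fun_eq_iff shift_def algebra_simps)
  then show ?thesis by (simp add: int_iterate_def shift_funpow inv_shift)
qed

lemma measure_automorphism_shift: "measure_automorphism noise (shift k)"
proof -
  have "bij (shift k)"
    by (rule o_bij[of "shift (- k)"]) (auto simp: fun_eq_iff shift_def)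
  then show ?thesis by (simp add: measure_automorphism_def inv_shift distr_shift)
qed

text \<open>The filler 1 has height 1, so a masked coordinate produces no positive peak at distance
  1 or more.\<close>

definition mask :: "int set \<Rightarrow> (int \<Rightarrow> real) \<Rightarrow> int \<Rightarrow> real" where
  "mask K \<omega> = (\<lambda>j. if j \<in> K then \<omega> j else 1)"

lemma measurable_mask: "mask K \<in> noise \<rightarrow>\<^sub>M noise"
  by (rule measurable_into_noise) (simp add: mask_def)

text \<open>Each mask factors through the restriction to its own index set, and restrictions of
  independent coordinates to disjoint sets are independent.\<close>

lemma indep_mask:
  assumes "K \<inter> L = {}" and A: "A \<in> sets noise" "B \<in> sets noise"
  shows "noise.prob ((mask K -` A \<inter> space noise) \<inter> (mask L -` B \<inter> space noise))
    = noise.prob (mask K -` A \<inter> space noise) * noise.prob (mask L -` B \<inter> space noise)"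
proof -
  have F: "(\<lambda>x j. if j \<in> I then x j else 1) \<in> (\<Pi>\<^sub>M i\<in>I. borel) \<rightarrow>\<^sub>M noise" for I :: "int set"
  proof (rule measurable_into_noise)
    show "(\<lambda>x. if i \<in> I then x i else 1) \<in> borel_measurable (\<Pi>\<^sub>M i\<in>I. borel)" for i
      by (cases "i \<in> I") (auto intro: measurable_component_singleton)
  qed
  have "noise.indep_var noise ((\<lambda>x j. if j \<in> K then x j else 1) \<circ> (\<lambda>\<omega>. restrict (\<lambda>i. \<omega> i) K))
      noise ((\<lambda>x j. if j \<in> L then x j else 1) \<circ> (\<lambda>\<omega>. restrict (\<lambda>i. \<omega> i) L))"
    using assms(1) by (intro noise.indep_var_compose[OF noise.indep_var_restrict[OF indep_coordinates]] F) auto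
  moreover have "(\<lambda>x j. if j \<in> I then x j else 1) \<circ> (\<lambda>\<omega>. restrict (\<lambda>i. \<omega> i) I) = mask I" for I
    by (auto simp: fun_eq_iff mask_def)
  ultimately have "noise.indep_var noise (mask K) noise (mask L)" by simp
  from noise.indep_varD[OF this A] show ?thesis
    by (simp add: vimage_def Int_def conj_ac)
qed

lemma tame_max_iff: "tame \<omega> \<longleftrightarrow> bdd_above (range (\<lambda>j. max 0 (peak \<omega> j)))"
proof
  assume "tame \<omega>"
  then show "bdd_above (range (\<lambda>j. max 0 (peak \<omega> j)))" using envelope_bdd[of \<omega>] by simp
next
  assume "bdd_above (range (\<lambda>j. max 0 (peak \<omega> j)))"
  then obtain K where "\<And>j. max 0 (peak \<omega> j) \<le> K" by (auto simp: bdd_above_def)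
  then show "tame \<omega>" unfolding tame_def by (intro bdd_aboveI[of _ K]) auto
qed

text \<open>The positive parts of the peaks determine tameness as well as the supremum, so the case
  distinction in \<open>envelope\<close> also agrees.\<close>

lemma envelope_cong:
  assumes "\<And>j. max 0 (peak \<omega> j) = max 0 (peak \<omega>' j)"
  shows "envelope \<omega> = envelope \<omega>'"
  unfolding envelope_def tame_max_iff assms ..

lemma height_1: "height 1 = 1"
  by (simp add: height_def)

text \<open>Seen from \<open>k\<close>, no position outside \<open>K\<close> has a positive peak,
  before or after masking; the 1 in the maximum accounts for the height of the filler.\<close>

lemma envelope_shift_mask:
  assumes "\<And>j. j \<notin> K \<Longrightarrow> max 1 (height (\<omega> j)) \<le> \<bar>real_of_int (j - k)\<bar>"
  shows "envelope (shift k (mask K \<omega>)) = envelope (shift k \<omega>)"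
proof (rule envelope_cong)
  fix j
  show "max 0 (peak (shift k (mask K \<omega>)) j) = max 0 (peak (shift k \<omega>) j)"
    using assms[of "j + k"] height_1 by (auto simp: peak_def shift_def mask_def)
qed

lemma observable_shift:
  "observable (shift k \<omega>) = sgn (\<omega> k) + envelope (shift k \<omega>) - envelope (shift (k + 1) \<omega>)"
  by (simp add: observable_def shift_apply add.commute)

text \<open>The observable at time \<open>k\<close> reads the sign at \<open>k\<close> and the
  envelopes at \<open>k\<close> and \<open>k + 1\<close>, which explains the three
  hypotheses.\<close>

lemma observable_shift_mask:
  assumes "k \<in> K"
    and "\<And>j. j \<notin> K \<Longrightarrow> max 1 (height (\<omega> j)) \<le> \<bar>real_of_int (j - k)\<bar>"
    and "\<And>j. j \<notin> K \<Longrightarrow> max 1 (height (\<omega> j)) \<le> \<bar>real_of_int (j - (k + 1))\<bar>"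
  shows "observable (shift k (mask K \<omega>)) = observable (shift k \<omega>)"
  using envelope_shift_mask[OF assms(2)] envelope_shift_mask[OF assms(3)] assms(1)
  by (simp add: observable_shift) (simp add: mask_def)

abbreviation process :: "int \<Rightarrow> (int \<Rightarrow> real) \<Rightarrow> real" where
  "process k \<equiv> \<lambda>\<omega>. observable (shift k \<omega>)"

text \<open>The noise is cut at \<open>c\<close>: the past may read only coordinates up to
  \<open>c\<close>, the future only those beyond. The event \<open>E\<close> collects the peaks that
  reach across the cut far enough to matter.\<close>

lemma beta_mixing_le_of_mask:
  assumes E: "E \<in> sets noise"
    and past: "\<And>\<omega> k. \<omega> \<notin> E \<Longrightarrow> k \<le> 0 \<Longrightarrow> process k (mask {..c} \<omega>) = process k \<omega>"
    and future: "\<And>\<omega> k. \<omega> \<notin> E \<Longrightarrow> k \<ge> int N \<Longrightarrow> process k (mask {c<..} \<omega>) = process k \<omega>"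
  shows "beta_mixing noise process N \<le> 3 * noise.prob E"
proof -
  have sub: "generated_sigma noise process I \<subseteq> sets noise" for I
    by (rule generated_sigma_subset) measurable
  show ?thesis
    unfolding beta_mixing_def
  proof (rule beta_coeff_le_coupling[where \<rho> = "mask {..c}" and \<sigma> = "mask {c<..}"])
    show "mask {..c} \<omega> \<in> A \<longleftrightarrow> \<omega> \<in> A"
      if "A \<in> generated_sigma noise process {..0}" "\<omega> \<in> space noise - E" for A \<omega>
      using that past by (intro generated_sigma_mem_cong[OF that(1)]) auto
    show "mask {c<..} \<omega> \<in> A \<longleftrightarrow> \<omega> \<in> A"
      if "A \<in> generated_sigma noise process {int N..}" "\<omega> \<in> space noise - E" for A \<omega>
      using that future by (intro generated_sigma_mem_cong[OF that(1)]) auto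
    show "noise.prob (mask {..c} -` A \<inter> space noise \<inter> (mask {c<..} -` B \<inter> space noise)) =
        noise.prob (mask {..c} -` A \<inter> space noise) * noise.prob (mask {c<..} -` B \<inter> space noise)"
      if "A \<in> generated_sigma noise process {..0}" "B \<in> generated_sigma noise process {int N..}" for A B
      using that sub by (intro indep_mask) auto
  qed (use sub E in \<open>auto intro: space_in_generated_sigma[of noise, simplified] measurable_mask prob_space_noise\<close>)
qed

lemma beta_mixing_observable:
  assumes "N \<ge> 1"
  shows "beta_mixing noise process N \<le> 36 / real N"
proof (cases "N = 1")
  case True
  \<comment> \<open>For \<open>N = 1\<close> the midpoint would be 0, so the whole space is declared
    bad; the resulting bound 3 is below 36.\<close>
  have "beta_mixing noise process N \<le> 3 * noise.prob UNIV"
    by (rule beta_mixing_le_of_mask) (use sets.top[of noise] in auto)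
  then show ?thesis using True by simp
next
  case False
  define c where "c = int (N div 2)"
  have c: "real_of_int c \<ge> 1" "real_of_int c \<ge> real N / 4" "real N - real_of_int c \<ge> real N / 2"
  proof -
    have "1 \<le> N div 2" "N \<le> 2 * (N div 2) + 1" "2 * (N div 2) \<le> N" using False assms by linarith+
    then have "1 \<le> real (N div 2)" "real N \<le> 2 * real (N div 2) + 1" "2 * real (N div 2) \<le> real N"
      by linarith+
    then show "real_of_int c \<ge> 1" "real_of_int c \<ge> real N / 4" "real N - real_of_int c \<ge> real N / 2"
      unfolding c_def by simp_all
  qed
  \<comment> \<open>The observable at time 0 also reads the envelope at site 1, and position
    \<open>c + 1 + i\<close> is at distance \<open>c + i\<close> from there. In \<open>E2\<close>
    the nearest site that the future reads is \<open>N\<close>, at distance \<open>N - c + i\<close>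
    from \<open>c - i\<close>.\<close>
  define E1 where "E1 = {\<omega>. \<exists>i::nat. real_of_int c + real i \<le> height (\<omega> (c + 1 + int i))}"
  define E2 where "E2 = {\<omega>. \<exists>i::nat. real N - real_of_int c + real i \<le> height (\<omega> (c - int i))}"
  have [measurable]: "E1 \<in> sets noise" "E2 \<in> sets noise" unfolding E1_def E2_def by measurable
  have "beta_mixing noise process N \<le> 3 * noise.prob (E1 \<union> E2)"
  proof (rule beta_mixing_le_of_mask[where c = c])
    fix \<omega> k assume \<omega>: "\<omega> \<notin> E1 \<union> E2"
    show "process k (mask {..c} \<omega>) = process k \<omega>" if k: "k \<le> 0"
    proof -
      have *: "max 1 (height (\<omega> j)) \<le> real_of_int (j - 1)" if "j > c" for j
      proof -
        have "\<not> real_of_int c + real (nat (j - c - 1)) \<le> height (\<omega> (c + 1 + int (nat (j - c - 1))))"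
          using \<omega> unfolding E1_def by blast
        then show ?thesis using that c by simp
      qed
      have "max 1 (height (\<omega> j)) \<le> \<bar>real_of_int (j - l)\<bar>" if "j \<notin> {..c}" "l \<le> 1" for j l
        using *[of j] that by simp
      from this[of _ k] this[of _ "k + 1"] show ?thesis
        using k c by (intro observable_shift_mask) auto
    qed
    show "process k (mask {c<..} \<omega>) = process k \<omega>" if k: "k \<ge> int N"
    proof -
      have *: "max 1 (height (\<omega> j)) \<le> real_of_int (int N - j)" if "j \<le> c" for j
      proof -
        have "\<not> real N - real_of_int c + real (nat (c - j)) \<le> height (\<omega> (c - int (nat (c - j))))"
          using \<omega> unfolding E2_def by blast
        then show ?thesis using that c by simp
      qed
      have "max 1 (height (\<omega> j)) \<le> \<bar>real_of_int (j - l)\<bar>" if "j \<notin> {c<..}" "l \<ge> int N" for j l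
        using *[of j] that by simp
      from this[of _ k] this[of _ "k + 1"] show ?thesis
        using k c by (intro observable_shift_mask) auto
    qed
  qed measurable
  also have "noise.prob (E1 \<union> E2) \<le> noise.prob E1 + noise.prob E2" by (rule measure_Un_le) auto
  also have "\<dots> \<le> 2 / real_of_int c + 2 / (real N - real_of_int c)"
    unfolding E1_def E2_def using c False assms by (intro add_mono prob_tail_heights) auto
  \<comment> \<open>The two tails contribute \<open>8 / N\<close> and \<open>4 / N\<close>; the
    factor 3 of the coupling bound makes 36.\<close>
  also have "\<dots> \<le> 2 / (real N / 4) + 2 / (real N / 2)"
    using c assms by (intro add_mono divide_left_mono mult_pos_pos) auto
  also have "3 * \<dots> = 36 / real N" using assms by (simp add: field_simps)
  finally show ?thesis by simp
qed


section \<open>Failure of the invariance principle\<close>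

lemma measurable_pred_le [measurable (raw)]:
  fixes f g :: "'a \<Rightarrow> real"
  assumes "f \<in> borel_measurable M" "g \<in> borel_measurable M"
  shows "Measurable.pred M (\<lambda>\<omega>. f \<omega> \<le> g \<omega>)"
  unfolding pred_def using assms by (rule borel_measurable_le)

text \<open>Each of the \<open>n\<close> independent heights reaches \<open>3 * sqrt n\<close> with
  probability \<open>1 / (9 * n)\<close>, so all of them fail with probability
  \<open>(1 - 1 / (9 * n))^n\<close>, at most \<open>exp (- 1 / 9)\<close>.\<close>

lemma prob_ex_height_ge:
  assumes "n > 0"
  shows "1 - exp (- 1 / 9) \<le> noise.prob {\<omega>. \<exists>j<n. 3 * sqrt (real n) \<le> height (\<omega> (int j))}"
proof -
  let ?r = "3 * sqrt (real n)"
  have "sqrt (real n) \<ge> 1" using assms by simp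
  then have r: "?r \<ge> 1" "?r\<^sup>2 = 9 * real n" by (linarith, simp add: power_mult_distrib)
  define A where "A j = {\<omega>. \<not> ?r \<le> height (\<omega> (int j))}" for j
  have prob_A: "noise.prob (A j) = 1 - 1 / (9 * real n)" for j
  proof -
    have "A j = space noise - {\<omega>. ?r \<le> height (\<omega> (int j))}" by (auto simp: A_def)
    also have "noise.prob \<dots> = 1 - noise.prob {\<omega>. ?r \<le> height (\<omega> (int j))}"
      by (rule noise.prob_compl) measurable
    finally show ?thesis using prob_height_ge[OF r(1)] r(2) by simp
  qed
  have "noise.prob (\<Inter>j\<in>{..<n}. (\<lambda>\<omega>. \<omega> (int j)) -` {x. \<not> ?r \<le> height x} \<inter> space noise)
      = (\<Prod>j\<in>{..<n}. noise.prob ((\<lambda>\<omega>. \<omega> (int j)) -` {x. \<not> ?r \<le> height x} \<inter> space noise))"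
    using assms by (intro noise.indep_varsD[OF indep_coordinates_inj[of int]]) (auto simp: inj_of_nat)
  then have "noise.prob (\<Inter>j\<in>{..<n}. A j) = (1 - 1 / (9 * real n)) ^ n"
    using prob_A by (simp add: A_def vimage_def)
  also have "\<dots> \<le> exp (- 1 / (9 * real n)) ^ n"
    using exp_ge_add_one_self[of "- 1 / (9 * real n)"] assms
    by (intro power_mono) (auto simp: field_simps)
  also have "\<dots> = exp (- 1 / 9)" using assms by (simp flip: exp_of_nat_mult)
  finally have "noise.prob (\<Inter>j\<in>{..<n}. A j) \<le> exp (- 1 / 9)" .
  moreover have "{\<omega>. \<exists>j<n. ?r \<le> height (\<omega> (int j))} = space noise - (\<Inter>j\<in>{..<n}. A j)"
    by (auto simp: A_def)
  moreover have "(\<Inter>j\<in>{..<n}. A j) = {\<omega>. \<forall>j<n. \<not> ?r \<le> height (\<omega> (int j))}" by (auto simp: A_def)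
  then have "(\<Inter>j\<in>{..<n}. A j) \<in> sets noise" by simp
  then have "noise.prob (space noise - (\<Inter>j\<in>{..<n}. A j)) = 1 - noise.prob (\<Inter>j\<in>{..<n}. A j)"
    by (rule noise.prob_compl)
  ultimately show ?thesis by simp
qed

text \<open>The sign flip preserves the heights and negates the sign sums, so the sign part works against
  the drop caused by a high peak with probability at most one half.\<close>

lemma prob_ex_height_ge_signed:
  fixes i :: "nat \<Rightarrow> nat"
  assumes "n > 0"
  shows "(1 - exp (- 1 / 9)) / 2 \<le> noise.prob {\<omega>. \<exists>j<n. 3 * sqrt (real n) \<le> height (\<omega> (int j)) \<and>
    sign_sum j \<omega> \<le> sign_sum (i j) \<omega>}"
proof -
  define P where "P \<omega> \<longleftrightarrow> (\<exists>j<n. 3 * sqrt (real n) \<le> height (\<omega> (int j)) \<and>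
    sign_sum j \<omega> \<le> sign_sum (i j) \<omega>)" for \<omega>
  have meas: "{\<omega>. P \<omega>} \<in> sets noise" "{\<omega>. P (flip UNIV \<omega>)} \<in> sets noise"
    unfolding P_def by measurable
  have flip: "sign_sum k (flip UNIV \<omega>) = - sign_sum k \<omega>" "height (flip UNIV \<omega> l) = height (\<omega> l)" for k l \<omega>
    by (simp_all add: sign_sum_def flip_apply sgn_minus sum_negf)
  have "1 - exp (- 1 / 9) \<le> noise.prob {\<omega>. \<exists>j<n. 3 * sqrt (real n) \<le> height (\<omega> (int j))}"
    by (rule prob_ex_height_ge[OF assms])
  also have "\<dots> \<le> noise.prob ({\<omega>. P \<omega>} \<union> {\<omega>. P (flip UNIV \<omega>)})"
  proof (rule noise.finite_measure_mono)
    have "P \<omega> \<or> P (flip UNIV \<omega>)" if "j < n" "3 * sqrt (real n) \<le> height (\<omega> (int j))" for \<omega> j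
      using that linear[of "sign_sum j \<omega>" "sign_sum (i j) \<omega>"] unfolding P_def flip by auto
    then show "{\<omega>. \<exists>j<n. 3 * sqrt (real n) \<le> height (\<omega> (int j))} \<subseteq> {\<omega>. P \<omega>} \<union> {\<omega>. P (flip UNIV \<omega>)}"
      by blast
  qed (use meas in simp)
  also have "\<dots> \<le> noise.prob {\<omega>. P \<omega>} + noise.prob {\<omega>. P (flip UNIV \<omega>)}"
    using meas by (rule measure_Un_le)
  also have "noise.prob {\<omega>. P (flip UNIV \<omega>)} = noise.prob {\<omega>. P \<omega>}"
    using meas by (intro prob_flip)
  finally show ?thesis by (simp add: P_def)
qed

text \<open>The envelope enters the partial sum at its end point with a minus sign. It pulls the sum
  down by at least \<open>3 * r\<close> at \<open>j\<close> but by at most \<open>r\<close> at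
  \<open>i\<close>, while the signs do not compensate; the gap of \<open>2 * r\<close> exceeds the
  required \<open>r\<close>.\<close>

lemma observable_drop:
  assumes "tame \<omega>" and r: "r \<ge> 1"
    and "3 * r \<le> height (\<omega> (int j))" "sign_sum j \<omega> \<le> sign_sum i \<omega>" "envelope (shift (int i) \<omega>) \<le> r"
  shows "\<bar>partial_sum (shift 1) observable j \<omega> / r - partial_sum (shift 1) observable i \<omega> / r\<bar> \<ge> 1"
proof -
  have "3 * r \<le> envelope (shift (int j) \<omega>)"
    using height_le_envelope_shift[OF assms(1), of "int j"] assms(3) by simp
  then have "partial_sum (shift 1) observable i \<omega> - partial_sum (shift 1) observable j \<omega> \<ge> r"
    using assms by (simp add: partial_sum_observable flip: sign_sum_def)
  then have "(partial_sum (shift 1) observable i \<omega> - partial_sum (shift 1) observable j \<omega>) / r \<ge> 1"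
    using r by (simp add: field_simps)
  then show ?thesis by (simp add: diff_divide_distrib)
qed

lemma observable_oscillates:
  fixes q :: nat
  assumes q: "q > 0"
  shows "\<forall>\<^sub>F n in sequentially. \<exists>E\<in>sets noise. noise.prob E \<ge> (1 - exp (- 1 / 9)) / 4 \<and>
    (\<forall>\<omega>\<in>E. \<exists>i\<le>n. \<exists>j\<le>n. \<bar>real j / real n - real i / real n\<bar> \<le> 1 / real q \<and>
      \<bar>partial_sum (shift 1) observable j \<omega> / sqrt (real n)
        - partial_sum (shift 1) observable i \<omega> / sqrt (real n)\<bar> \<ge> 1)"
proof -
  let ?\<eta> = "(1 - exp (- 1 / 9)) / 4 :: real"
  \<comment> \<open>There are \<open>2 * q + 1\<close> grid sites, each with an envelope above
    \<open>sqrt n\<close> with probability at most \<open>4 / sqrt n\<close>. The number of sites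
    stays fixed as \<open>n\<close> grows, so the grid is eventually low with high
    probability.\<close>
  have "(\<lambda>n. (2 * real q + 1) * (4 / sqrt (real n))) \<longlonglongrightarrow> 0" by real_asymp
  moreover have "?\<eta> > 0" by simp
  ultimately have "\<forall>\<^sub>F n in sequentially. (2 * real q + 1) * (4 / sqrt (real n)) < ?\<eta>"
    by (rule order_tendstoD)
  moreover have "\<forall>\<^sub>F n in sequentially. n \<ge> q" by (rule eventually_ge_at_top)
  ultimately show ?thesis
  proof eventually_elim
    case (elim n)
    \<comment> \<open>The grid has mesh \<open>w\<close>, and \<open>i j\<close> is the last grid
      point not after \<open>j\<close>. Rounding down gives \<open>w * q \<le> n\<close>, so
      \<open>j\<close> and \<open>i j\<close> are at rescaled distance at most
      \<open>1 / q\<close>.\<close>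
    define w where "w = n div q"
    define i where "i j = w * (j div w)" for j
    have n: "n > 0" and w: "w > 0" "w * q \<le> n" using elim(2) q by (auto simp: w_def div_greater_zero_iff)
    have r: "sqrt (real n) \<ge> 1" using n by simp
    define P where "P \<omega> \<longleftrightarrow> (\<exists>j<n. 3 * sqrt (real n) \<le> height (\<omega> (int j)) \<and>
      sign_sum j \<omega> \<le> sign_sum (i j) \<omega>)" for \<omega>
    define Q where "Q a \<omega> \<longleftrightarrow> sqrt (real n) < envelope (shift (int (w * a)) \<omega>)" for a \<omega>
    define E where "E = {\<omega>. tame \<omega> \<and> P \<omega> \<and> (\<forall>a\<le>2 * q. \<not> Q a \<omega>)}"
    have [measurable]: "Measurable.pred noise P" "\<And>a. Measurable.pred noise (Q a)"
      unfolding P_def[abs_def] Q_def[abs_def] by measurable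
    have E: "E \<in> sets noise" unfolding E_def by measurable
    have "(1 - exp (- 1 / 9)) / 2 \<le> noise.prob {\<omega>. P \<omega>}"
      unfolding P_def by (rule prob_ex_height_ge_signed[OF n])
    also have "\<dots> \<le> noise.prob (E \<union> {\<omega>. \<exists>a\<in>{..2 * q}. Q a \<omega>})"
      using E AE_tame by (intro noise.finite_measure_mono_AE) (auto simp: E_def)
    also have "\<dots> \<le> noise.prob E + noise.prob {\<omega>. \<exists>a\<in>{..2 * q}. Q a \<omega>}"
      using E by (intro measure_Un_le) auto
    also have "{\<omega>. \<exists>a\<in>{..2 * q}. Q a \<omega>} = (\<Union>a\<in>{..2 * q}. {\<omega>. Q a \<omega>})" by auto
    also have "noise.prob \<dots> \<le> (\<Sum>a\<in>{..2 * q}. noise.prob {\<omega>. Q a \<omega>})"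
      by (rule noise.finite_measure_subadditive_finite) auto
    also have "\<dots> \<le> (\<Sum>a\<in>{..2 * q}. 4 / sqrt (real n))"
      unfolding Q_def by (intro sum_mono prob_envelope_shift_gt r)
    also have "\<dots> = (2 * real q + 1) * (4 / sqrt (real n))" by simp
    finally have "(1 - exp (- 1 / 9)) / 2 \<le> noise.prob E + (2 * real q + 1) * (4 / sqrt (real n))" by - simp_all
    \<comment> \<open>The probability of a high signed peak is at least \<open>2 * ?\<eta>\<close>,
      and the exceptional grid event consumes less than \<open>?\<eta>\<close> of it.\<close>
    with elim(1) have "?\<eta> \<le> noise.prob E" by linarith
    moreover have "\<exists>i\<le>n. \<exists>j\<le>n. \<bar>real j / real n - real i / real n\<bar> \<le> 1 / real q \<and>
      \<bar>partial_sum (shift 1) observable j \<omega> / sqrt (real n)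
        - partial_sum (shift 1) observable i \<omega> / sqrt (real n)\<bar> \<ge> 1" if \<omega>: "\<omega> \<in> E" for \<omega>
    proof -
      obtain j where j: "j < n" "3 * sqrt (real n) \<le> height (\<omega> (int j))" "sign_sum j \<omega> \<le> sign_sum (i j) \<omega>"
        using \<omega> by (auto simp: E_def P_def)
      \<comment> \<open>Rounding down may leave more than \<open>q\<close> blocks, but since
        \<open>w \<ge> 1\<close> there are at most \<open>2 * q\<close>, which is why
        \<open>E\<close> controls the grid that far.\<close>
      have "n < q * Suc w" using dividend_less_times_div[OF q, of n] by (simp add: w_def)
      also have "\<dots> \<le> q * (2 * w)" using w by (intro mult_left_mono) auto
      finally have "j < (2 * q) * w" using j(1) by (simp add: ac_simps)
      then have "j div w < 2 * q" by (rule less_mult_imp_div_less)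
      then have "envelope (shift (int (i j)) \<omega>) \<le> sqrt (real n)"
        using \<omega> unfolding E_def Q_def i_def by (auto simp: not_less)
      from observable_drop[OF _ r j(2,3) this] \<omega>
      have "\<bar>partial_sum (shift 1) observable j \<omega> / sqrt (real n)
        - partial_sum (shift 1) observable (i j) \<omega> / sqrt (real n)\<bar> \<ge> 1" by (simp add: E_def)
      moreover have ij: "i j \<le> j" "j \<le> i j + w"
        using mod_less_divisor[OF w(1), of j] mult_div_mod_eq[of w j] unfolding i_def by linarith+
      have "\<bar>real j / real n - real (i j) / real n\<bar> \<le> 1 / real q"
      proof -
        have "\<bar>real j / real n - real (i j) / real n\<bar> = (real j - real (i j)) / real n"
          using ij by (simp add: diff_divide_distrib[symmetric])
        also have "\<dots> \<le> real w / real n" using ij by (intro divide_right_mono) linarith+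
        also have "\<dots> \<le> 1 / real q"
          using w(2) n q by (simp add: field_simps flip: of_nat_mult)
        finally show ?thesis .
      qed
      ultimately show ?thesis using j(1) ij(1) by (intro exI[of _ "i j"] conjI exI[of _ j]) auto
    qed
    ultimately show ?case using E by blast
  qed
qed

text \<open>At grid times the interpolation term vanishes, so the polygonal and the step path share
  the values from which the oscillation is read off.\<close>

lemma path_at_grid:
  assumes "0 < n" "j \<le> n"
  shows "step_path T f a n \<omega> (real j / real n) = partial_sum T f j \<omega> / a n"
    and "polygonal_path T f a n \<omega> (real j / real n) = partial_sum T f j \<omega> / a n"
  using assms
  by (simp_all add: step_path_def step_sum_def polygonal_path_def polygonal_sum_def)

lemma observable_path_oscillates:
  assumes X: "\<And>n \<omega> j. 0 < n \<Longrightarrow> j \<le> n \<Longrightarrow>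
      X n \<omega> (real j / real n) = partial_sum (shift 1) observable j \<omega> / sqrt (real n)" and "q > 0"
  shows "\<forall>\<^sub>F n in sequentially. \<exists>E\<in>sets noise. noise.prob E \<ge> (1 - exp (- 1 / 9)) / 4 \<and>
      (\<forall>\<omega>\<in>E. \<exists>s\<in>{0..1}. \<exists>t\<in>{0..1}. \<bar>s - t\<bar> \<le> 1 / real q \<and> \<bar>X n \<omega> s - X n \<omega> t\<bar> \<ge> 1)"
  using observable_oscillates[OF assms(2)] eventually_gt_at_top[of 0]
proof eventually_elim
  case (elim n)
  then obtain E where E: "E \<in> sets noise" "noise.prob E \<ge> (1 - exp (- 1 / 9)) / 4"
    and osc: "\<And>\<omega>. \<omega> \<in> E \<Longrightarrow> \<exists>i\<le>n. \<exists>j\<le>n. \<bar>real j / real n - real i / real n\<bar> \<le> 1 / real q \<and>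
      \<bar>partial_sum (shift 1) observable j \<omega> / sqrt (real n)
        - partial_sum (shift 1) observable i \<omega> / sqrt (real n)\<bar> \<ge> 1" by blast
  have "\<exists>s\<in>{0..1}. \<exists>t\<in>{0..1}. \<bar>s - t\<bar> \<le> 1 / real q \<and> \<bar>X n \<omega> s - X n \<omega> t\<bar> \<ge> 1" if \<omega>: "\<omega> \<in> E" for \<omega>
  proof -
    from osc[OF \<omega>] obtain i j where "i \<le> n" "j \<le> n" "\<bar>real j / real n - real i / real n\<bar> \<le> 1 / real q"
      "\<bar>X n \<omega> (real j / real n) - X n \<omega> (real i / real n)\<bar> \<ge> 1"
      using X elim(2) by metis
    then show ?thesis
      using elim(2) by (intro bexI[of _ "real j / real n"] bexI[of _ "real i / real n"]) auto
  qed
  then show ?case using E by blast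
qed

text \<open>The oscillation criterion is applied once per space, with the same lower bound on the
  probability; only measurability and the comparison of nearby paths depend on the metric.\<close>

lemma wip_fails:
  "\<not> wip_C noise (shift 1) observable (\<lambda>n. sqrt (real n))"
  "\<not> wip_D noise (shift 1) observable (\<lambda>n. sqrt (real n))"
proof -
  have \<eta>: "(1 - exp (- 1 / 9)) / 4 > (0::real)" by simp
  have "\<not> weak_conv_metric C01 (\<lambda>n. distr noise (metric_borel C01)
      (polygonal_path (shift 1) observable (\<lambda>n. sqrt (real n)) n)) W" if "brownian_law C01 W" for W
  proof (rule not_weak_conv_brownian_of_oscillation[where m = C01, OF _ prob_space_noise _ that \<eta>])
    show "polygonal_path (shift 1) observable (\<lambda>n. sqrt (real n)) n \<in> noise \<rightarrow>\<^sub>M metric_borel C01" for n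
      by (rule polygonal_path_measurable) measurable
  qed (erule (5) C01_near, rule observable_path_oscillates, erule (1) path_at_grid(2))
  then show "\<not> wip_C noise (shift 1) observable (\<lambda>n. sqrt (real n))" by (auto simp: wip_C_def)
  have "\<not> weak_conv_metric D01 (\<lambda>n. distr noise (metric_borel D01)
      (step_path (shift 1) observable (\<lambda>n. sqrt (real n)) n)) W" if "brownian_law D01 W" for W
  proof (rule not_weak_conv_brownian_of_oscillation[where m = D01, OF _ prob_space_noise _ that \<eta>])
    show "step_path (shift 1) observable (\<lambda>n. sqrt (real n)) n \<in> noise \<rightarrow>\<^sub>M metric_borel D01" for n
      by (rule step_path_measurable) measurable
  qed (erule (5) D01_near, rule observable_path_oscillates, erule (1) path_at_grid(1))
  then show "\<not> wip_D noise (shift 1) observable (\<lambda>n. sqrt (real n))" by (auto simp: wip_D_def)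
qed


theorem theoremA:
  fixes \<delta> :: real
  assumes "\<delta> > 0"
  shows "\<exists>(M :: (int \<Rightarrow> real) measure) T f.
    prob_space M \<and> measure_automorphism M T \<and>
    f \<in> borel_measurable M \<and> integrable M (\<lambda>\<omega>. (f \<omega>)\<^sup>2) \<and> (\<integral>\<omega>. f \<omega> \<partial>M) = 0 \<and>
    clt_holds M T f (\<lambda>n. sqrt (real n)) \<and>
    \<not> wip_C M T f (\<lambda>n. sqrt (real n)) \<and> \<not> wip_D M T f (\<lambda>n. sqrt (real n)) \<and>
    same_order (sum_variance M T f) real \<and>
    (\<exists>C>0. \<forall>N\<ge>1. beta_mixing M (\<lambda>k \<omega>. f (int_iterate M T k \<omega>)) N
                     \<le> C / real N powr (1 / 2 - \<delta>)) \<and>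
    (\<forall>p>0. integrable M (\<lambda>\<omega>. \<bar>f (int_iterate M T 0 \<omega>)\<bar> powr p))"
proof (rule exI[of _ noise], rule exI[of _ "shift 1"], rule exI[of _ observable], intro conjI)
  show "prob_space noise" by (rule prob_space_noise)
  show "measure_automorphism noise (shift 1)" by (rule measure_automorphism_shift)
  show "observable \<in> borel_measurable noise" by measurable
  have bound: "\<bar>observable \<omega>\<bar> powr p \<le> 2 powr p" if "p > 0" for \<omega> p
    using observable_bounded[of \<omega>] that by (intro powr_mono2) auto
  have square: "(observable \<omega>)\<^sup>2 \<le> 2\<^sup>2" for \<omega>
    using observable_bounded[of \<omega>] by (intro abs_le_square_iff[THEN iffD1]) simp
  show "integrable noise (\<lambda>\<omega>. (observable \<omega>)\<^sup>2)"
    by (rule noise.integrable_const_bound[of _ "2\<^sup>2"]) (use square in simp, measurable)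
  show "(\<integral>\<omega>. observable \<omega> \<partial>noise) = 0" by (rule integral_observable)
  show "clt_holds noise (shift 1) observable (\<lambda>n. sqrt (real n))" by (rule clt_observable)
  show "\<not> wip_C noise (shift 1) observable (\<lambda>n. sqrt (real n))"
    "\<not> wip_D noise (shift 1) observable (\<lambda>n. sqrt (real n))" by (rule wip_fails)+
  show "same_order (sum_variance noise (shift 1) observable) real"
    unfolding same_order_def
  proof (intro exI[of _ 25] conjI allI impI)
    fix N :: nat
    show "inverse 25 * sum_variance noise (shift 1) observable N \<le> real N"
      using sum_variance_observable(2)[of N] by simp
    show "real N \<le> 25 * sum_variance noise (shift 1) observable N"
      using sum_variance_observable(1)[of N] by simp
  qed simp
  show "\<exists>C>0. \<forall>N\<ge>1. beta_mixing noise (\<lambda>k \<omega>. observable (int_iterate noise (shift 1) k \<omega>)) N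
      \<le> C / real N powr (1 / 2 - \<delta>)"
  proof (intro exI[of _ 36] conjI allI impI)
    fix N :: nat assume N: "N \<ge> 1"
    \<comment> \<open>As \<open>1 / 2 - \<delta>\<close> is below 1, the rate \<open>36 / N\<close>
      is stronger than the one demanded.\<close>
    have "real N powr (1 / 2 - \<delta>) \<le> real N powr 1"
      using N assms by (intro powr_mono) auto
    then have "36 / real N \<le> 36 / real N powr (1 / 2 - \<delta>)"
      using N by (intro divide_left_mono) auto
    with beta_mixing_observable[OF N]
    show "beta_mixing noise (\<lambda>k \<omega>. observable (int_iterate noise (shift 1) k \<omega>)) N
        \<le> 36 / real N powr (1 / 2 - \<delta>)"
      by (simp add: int_iterate_shift)
  qed simp
  show "\<forall>p>0. integrable noise (\<lambda>\<omega>. \<bar>observable (int_iterate noise (shift 1) 0 \<omega>)\<bar> powr p)"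
  proof (intro allI impI)
    fix p :: real assume p: "p > 0"
    show "integrable noise (\<lambda>\<omega>. \<bar>observable (int_iterate noise (shift 1) 0 \<omega>)\<bar> powr p)"
      using bound[OF p] by (intro noise.integrable_const_bound[of _ "2 powr p"]) (auto simp: int_iterate_shift)
  qed
qed

end
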